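(* Let $\phi:N^2\to\mathbb{R}^3$ be a positive definite elliptic or hyperbolic affine sphere with mean curvature $\varepsilon_1=\pm1$ and affine normal $-\varepsilon_1\phi$, and let $\gamma=(\gamma_1,\gamma_2):I\to\mathbb{R}^2$ be a curve. Define $\varphi:I\times N^2\to\mathbb{R}^4$ by $\varphi(t,v,w)=(\gamma_1(t),\gamma_2(t)\phi(v,w))$. (i) If $\gamma$ satisfies $\gamma_2^2\,|\gamma_1\gamma_2'-\gamma_1'\gamma_2|^5=\operatorname{sign}(\gamma_1'\gamma_2\varepsilon_1)\,(\gamma_1'\gamma_2''-\gamma_1''\gamma_2')\,(\gamma_1')^2\neq0$, then $\varphi$ defines a 3-dimensional indefinite proper affine hypersphere. (ii) If $\gamma$ satisfies $\gamma_2^2\,|\gamma_2'|^5=\operatorname{sign}(\gamma_1'\gamma_2\varepsilon_1)\,(\gamma_1'\gamma_2''-\gamma_1''\gamma_2')\,(\gamma_1')^2\neq0$, then $\varphi$ defines a 3-dimensional indefinite improper affine hypersphere.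
   Context: $D$ is the flat connection and $\det$ the volume form of $\mathbb{R}^{n+1}$. For a nondegenerate immersed hypersurface $\varphi:M^n\to\mathbb{R}^{n+1}$ the affine (Blaschke) normal $\xi$ is the transverse vector field, unique up to sign, such that (identifying tangent vectors with their images under $\varphi_*$) $D_XY=\nabla_XY+h(X,Y)\xi$, $D_X\xi=-SX$ with $SX$ tangential, and the volume form $\det(\varphi_*X_1,\dots,\varphi_*X_n,\xi)$ equals (up to orientation) the volume form $|\det h|^{1/2}$ of $h$. $h$ is the affine metric, $S$ the shape operator. $\varphi$ is an affine (hyper)sphere if $S=H\,\mathrm{Id}$ with $H$ constant (the mean curvature); it is proper if $H\neq0$, improper if $H=0$, and indefinite if $h$ is indefinite. A 2-dimensional affine sphere in $\mathbb{R}^3$ is positive definite if (for a suitable sign of $\xi$) $h$ is positive definite, and is then elliptic if $H>0$ and hyperbolic if $H<0$. Curves are smooth, $I$ is an open interval, and the conditions on $\gamma$ are required for all $t\in I$; primes denote $d/dt$. *)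

theory Defs
  imports "HOL-Analysis.Analysis"
begin

section \<open>Smooth maps and smooth manifolds\<close>

text \<open>
  These notions are meant for open sets \<open>U\<close>: the derivatives are two-sided and taken
  in the ambient space.
\<close>

primrec Ck_on :: "nat \<Rightarrow> 'a::real_normed_vector set \<Rightarrow> ('a \<Rightarrow> 'b::real_normed_vector) \<Rightarrow> bool"
  where
    "Ck_on 0 U f \<longleftrightarrow> continuous_on U f"
  | "Ck_on (Suc k) U f \<longleftrightarrow>
       (\<forall>u\<in>U. f differentiable (at u)) \<and>
       (\<forall>a. Ck_on k U (\<lambda>u. frechet_derivative f (at u) a))"

definition smooth_on :: "'a::real_normed_vector set \<Rightarrow> ('a \<Rightarrow> 'b::real_normed_vector) \<Rightarrow> bool"
  where "smooth_on U f \<longleftrightarrow> (\<forall>k. Ck_on k U f)"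

text \<open>
  An atlas consists of local parametrizations \<open>(U, x)\<close>, that is, inverses of charts:
  \<open>x\<close> maps the open set \<open>U\<close> of coordinates homeomorphically onto an open part of the manifold.
\<close>

type_synonym ('n, 'p) atlas = "((real^'n) set \<times> (real^'n \<Rightarrow> 'p)) set"

definition smooth_manifold :: "'p topology \<Rightarrow> ('n::finite, 'p) atlas \<Rightarrow> bool"
  where "smooth_manifold M \<A> \<longleftrightarrow>
    Hausdorff_space M \<and> second_countable M \<and>
    (\<Union>(U, x)\<in>\<A>. x ` U) = topspace M \<and>
    (\<forall>(U, x)\<in>\<A>. open U \<and> openin M (x ` U) \<and>
       homeomorphic_map (top_of_set U) (subtopology M (x ` U)) x) \<and>
    (\<forall>(U, x)\<in>\<A>. \<forall>(V, y)\<in>\<A>. smooth_on {u \<in> U. x u \<in> y ` V} (inv_into V y \<circ> x))"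

definition smooth_map :: "('n::finite, 'p) atlas \<Rightarrow> ('p \<Rightarrow> real^'m) \<Rightarrow> bool"
  where "smooth_map \<A> f \<longleftrightarrow> (\<forall>(U, x)\<in>\<A>. smooth_on U (f \<circ> x))"

section \<open>Affine hypersurfaces\<close>

text \<open>
  Tangent vectors of an immersed manifold are identified with their images under the
  differential of the immersion, so that tangent spaces are subspaces of the ambient space.
\<close>

definition tangent_space :: "('n::finite, 'p) atlas \<Rightarrow> ('p \<Rightarrow> real^'m) \<Rightarrow> 'p \<Rightarrow> (real^'m) set"
  where "tangent_space \<A> \<phi> p =
    {frechet_derivative (\<phi> \<circ> x) (at u) a | U x u a. (U, x) \<in> \<A> \<and> u \<in> U \<and> x u = p}"

definition immersed_hypersurface ::
  "'p topology \<Rightarrow> ('n::finite, 'p) atlas \<Rightarrow> ('p \<Rightarrow> real^'m) \<Rightarrow> bool"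
  where "immersed_hypersurface M \<A> \<phi> \<longleftrightarrow>
    CARD('m) = CARD('n) + 1 \<and> smooth_manifold M \<A> \<and> smooth_map \<A> \<phi> \<and>
    (\<forall>(U, x)\<in>\<A>. \<forall>u\<in>U. inj (frechet_derivative (\<phi> \<circ> x) (at u)))"

definition transversal_field ::
  "'p topology \<Rightarrow> ('n::finite, 'p) atlas \<Rightarrow> ('p \<Rightarrow> real^'m) \<Rightarrow> ('p \<Rightarrow> real^'m) \<Rightarrow> bool"
  where "transversal_field M \<A> \<phi> \<xi> \<longleftrightarrow>
    smooth_map \<A> \<xi> \<and> (\<forall>p\<in>topspace M. \<xi> p \<notin> tangent_space \<A> \<phi> p)"

text \<open>
  \<open>D\<^sub>X Y = \<nabla>\<^sub>X Y + h(X, Y) \<xi>\<close> with \<open>\<nabla>\<^sub>X Y\<close> tangential. The vector fields \<open>X\<close>, \<open>Y\<close> range over all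
  smooth fields on coordinate domains and are given by their components.
\<close>

definition gauss_formula ::
  "('n::finite, 'p) atlas \<Rightarrow> ('p \<Rightarrow> real^'m) \<Rightarrow> ('p \<Rightarrow> real^'m) \<Rightarrow>
   ('p \<Rightarrow> real^'m \<Rightarrow> real^'m \<Rightarrow> real) \<Rightarrow> bool"
  where "gauss_formula \<A> \<phi> \<xi> h \<longleftrightarrow>
    (\<forall>(U, x)\<in>\<A>. \<forall>X Y. smooth_on U X \<longrightarrow> smooth_on U Y \<longrightarrow>
      (let d\<phi> = (\<lambda>u. frechet_derivative (\<phi> \<circ> x) (at u)) in
       \<forall>u\<in>U. \<exists>Z\<in>tangent_space \<A> \<phi> (x u).
         frechet_derivative (\<lambda>v. d\<phi> v (Y v)) (at u) (X u) =
           Z + h (x u) (d\<phi> u (X u)) (d\<phi> u (Y u)) *\<^sub>R \<xi> (x u)))"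

text \<open>\<open>D\<^sub>X \<xi> = - S X\<close> with \<open>S X\<close> tangential.\<close>

definition weingarten_formula ::
  "('n::finite, 'p) atlas \<Rightarrow> ('p \<Rightarrow> real^'m) \<Rightarrow> ('p \<Rightarrow> real^'m) \<Rightarrow>
   ('p \<Rightarrow> real^'m \<Rightarrow> real^'m) \<Rightarrow> bool"
  where "weingarten_formula \<A> \<phi> \<xi> S \<longleftrightarrow>
    (\<forall>(U, x)\<in>\<A>. \<forall>u\<in>U. \<forall>a.
      (let X = frechet_derivative (\<phi> \<circ> x) (at u) a in
       S (x u) X \<in> tangent_space \<A> \<phi> (x u) \<and>
       frechet_derivative (\<xi> \<circ> x) (at u) a = - S (x u) X))"

definition nondegenerate_metric ::
  "'p topology \<Rightarrow> ('n::finite, 'p) atlas \<Rightarrow> ('p \<Rightarrow> real^'m) \<Rightarrow>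
   ('p \<Rightarrow> real^'m \<Rightarrow> real^'m \<Rightarrow> real) \<Rightarrow> bool"
  where "nondegenerate_metric M \<A> \<phi> h \<longleftrightarrow>
    (\<forall>p\<in>topspace M. \<forall>v\<in>tangent_space \<A> \<phi> p.
      (\<forall>w\<in>tangent_space \<A> \<phi> p. h p v w = 0) \<longrightarrow> v = 0)"

text \<open>
  Equality, up to orientation, of the volume forms \<open>det(X\<^sub>1, \<dots>, X\<^sub>n, \<xi>)\<close> and
  \<open>\<bar>det h(X\<^sub>i, X\<^sub>j)\<bar>\<^sup>1\<^sup>/\<^sup>2\<close>. The bijection \<open>e\<close> only enumerates the rows of the determinant, with
  \<open>None\<close> standing for \<open>\<xi>\<close>; the absolute value does not depend on it.
\<close>

definition equal_volume_forms ::
  "'p topology \<Rightarrow> ('n::finite, 'p) atlas \<Rightarrow> ('p \<Rightarrow> real^'m) \<Rightarrow> ('p \<Rightarrow> real^'m) \<Rightarrow>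
   ('p \<Rightarrow> real^'m \<Rightarrow> real^'m \<Rightarrow> real) \<Rightarrow> bool"
  where "equal_volume_forms M \<A> \<phi> \<xi> h \<longleftrightarrow>
    (\<forall>p\<in>topspace M. \<forall>X :: 'n \<Rightarrow> real^'m. \<forall>e :: 'm \<Rightarrow> 'n option.
      (\<forall>i. X i \<in> tangent_space \<A> \<phi> p) \<longrightarrow> bij e \<longrightarrow>
      \<bar>det (\<chi> k. case e k of Some i \<Rightarrow> X i | None \<Rightarrow> \<xi> p)\<bar> =
        sqrt \<bar>det ((\<chi> i j. h p (X i) (X j)) :: real^'n^'n)\<bar>)"

text \<open>\<open>\<xi>\<close> is the affine normal of \<open>\<phi>\<close>, with affine metric \<open>h\<close> and shape operator \<open>S\<close>.\<close>

definition affine_normal ::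
  "'p topology \<Rightarrow> ('n::finite, 'p) atlas \<Rightarrow> ('p \<Rightarrow> real^'m) \<Rightarrow> ('p \<Rightarrow> real^'m) \<Rightarrow>
   ('p \<Rightarrow> real^'m \<Rightarrow> real^'m \<Rightarrow> real) \<Rightarrow> ('p \<Rightarrow> real^'m \<Rightarrow> real^'m) \<Rightarrow> bool"
  where "affine_normal M \<A> \<phi> \<xi> h S \<longleftrightarrow>
    immersed_hypersurface M \<A> \<phi> \<and> transversal_field M \<A> \<phi> \<xi> \<and>
    gauss_formula \<A> \<phi> \<xi> h \<and> weingarten_formula \<A> \<phi> \<xi> S \<and>
    nondegenerate_metric M \<A> \<phi> h \<and> equal_volume_forms M \<A> \<phi> \<xi> h"

section \<open>Affine spheres\<close>

definition affine_sphere ::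
  "'p topology \<Rightarrow> ('n::finite, 'p) atlas \<Rightarrow> ('p \<Rightarrow> real^'m) \<Rightarrow> ('p \<Rightarrow> real^'m) \<Rightarrow>
   ('p \<Rightarrow> real^'m \<Rightarrow> real^'m \<Rightarrow> real) \<Rightarrow> real \<Rightarrow> bool"
  where "affine_sphere M \<A> \<phi> \<xi> h H \<longleftrightarrow>
    (\<exists>S. affine_normal M \<A> \<phi> \<xi> h S \<and>
      (\<forall>p\<in>topspace M. \<forall>v\<in>tangent_space \<A> \<phi> p. S p v = H *\<^sub>R v))"

definition positive_definite_metric ::
  "'p topology \<Rightarrow> ('n::finite, 'p) atlas \<Rightarrow> ('p \<Rightarrow> real^'m) \<Rightarrow>
   ('p \<Rightarrow> real^'m \<Rightarrow> real^'m \<Rightarrow> real) \<Rightarrow> bool"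
  where "positive_definite_metric M \<A> \<phi> h \<longleftrightarrow>
    (\<forall>p\<in>topspace M. \<forall>v\<in>tangent_space \<A> \<phi> p. v \<noteq> 0 \<longrightarrow> h p v v > 0)"

definition indefinite_metric ::
  "'p topology \<Rightarrow> ('n::finite, 'p) atlas \<Rightarrow> ('p \<Rightarrow> real^'m) \<Rightarrow>
   ('p \<Rightarrow> real^'m \<Rightarrow> real^'m \<Rightarrow> real) \<Rightarrow> bool"
  where "indefinite_metric M \<A> \<phi> h \<longleftrightarrow>
    (\<forall>p\<in>topspace M. (\<exists>v\<in>tangent_space \<A> \<phi> p. h p v v > 0) \<and>
                    (\<exists>w\<in>tangent_space \<A> \<phi> p. h p w w < 0))"

text \<open>
  Reversing \<open>\<xi>\<close> reverses both \<open>h\<close> and \<open>H\<close>. In the two definitions below \<open>\<xi>\<close> is the choice of the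
  affine normal for which \<open>h\<close> is positive definite, and the sign of \<open>H\<close> refers to this choice.
\<close>

definition elliptic_affine_sphere ::
  "'p topology \<Rightarrow> (2, 'p) atlas \<Rightarrow> ('p \<Rightarrow> real^3) \<Rightarrow> ('p \<Rightarrow> real^3) \<Rightarrow> real \<Rightarrow> bool"
  where "elliptic_affine_sphere M \<A> \<phi> \<xi> H \<longleftrightarrow>
    (\<exists>h. affine_sphere M \<A> \<phi> \<xi> h H \<and> positive_definite_metric M \<A> \<phi> h) \<and> H > 0"

definition hyperbolic_affine_sphere ::
  "'p topology \<Rightarrow> (2, 'p) atlas \<Rightarrow> ('p \<Rightarrow> real^3) \<Rightarrow> ('p \<Rightarrow> real^3) \<Rightarrow> real \<Rightarrow> bool"
  where "hyperbolic_affine_sphere M \<A> \<phi> \<xi> H \<longleftrightarrow>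
    (\<exists>h. affine_sphere M \<A> \<phi> \<xi> h H \<and> positive_definite_metric M \<A> \<phi> h) \<and> H < 0"

definition indefinite_proper_affine_sphere ::
  "'p topology \<Rightarrow> ('n::finite, 'p) atlas \<Rightarrow> ('p \<Rightarrow> real^'m) \<Rightarrow> bool"
  where "indefinite_proper_affine_sphere M \<A> \<phi> \<longleftrightarrow>
    (\<exists>\<xi> h H. affine_sphere M \<A> \<phi> \<xi> h H \<and> indefinite_metric M \<A> \<phi> h \<and> H \<noteq> 0)"

definition indefinite_improper_affine_sphere ::
  "'p topology \<Rightarrow> ('n::finite, 'p) atlas \<Rightarrow> ('p \<Rightarrow> real^'m) \<Rightarrow> bool"
  where "indefinite_improper_affine_sphere M \<A> \<phi> \<longleftrightarrow>
    (\<exists>\<xi> h H. affine_sphere M \<A> \<phi> \<xi> h H \<and> indefinite_metric M \<A> \<phi> h \<and> H = 0)"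

section \<open>Warped products of a curve and a surface\<close>

text \<open>The product atlas on \<open>I \<times> N\<close>, with coordinates \<open>(t, v, w)\<close>.\<close>

definition interval_times_atlas :: "real set \<Rightarrow> (2, 'p) atlas \<Rightarrow> (3, real \<times> 'p) atlas"
  where "interval_times_atlas I \<A> =
    (\<lambda>(U, x). ({u. u $ 1 \<in> I \<and> vector [u $ 2, u $ 3] \<in> U},
               \<lambda>u. (u $ 1, x (vector [u $ 2, u $ 3])))) ` \<A>"

definition warped_immersion ::
  "(real \<Rightarrow> real) \<Rightarrow> (real \<Rightarrow> real) \<Rightarrow> ('p \<Rightarrow> real^3) \<Rightarrow> real \<times> 'p \<Rightarrow> real^4"
  where "warped_immersion \<gamma>1 \<gamma>2 \<phi> = (\<lambda>(t, p).
    vector [\<gamma>1 t, \<gamma>2 t * \<phi> p $ 1, \<gamma>2 t * \<phi> p $ 2, \<gamma>2 t * \<phi> p $ 3])"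

end

theory Submission
  imports Defs
begin

text \<open>
  Write \<open>\<Phi> = (\<gamma>\<^sub>1, \<gamma>\<^sub>2 \<phi>)\<close> and take \<open>\<xi> = c e\<^sub>1 - H \<Phi>\<close>, with \<open>(c, H) = (0, 1)\<close> in the proper and
  \<open>(1, 0)\<close> in the improper case; then \<open>D\<^sub>X \<xi> = - H X\<close> is immediate. With \<open>W\<close> the determinant of
  \<open>(c - H \<gamma>\<^sub>1, - H \<gamma>\<^sub>2)\<close> and \<open>\<gamma>'\<close>, and \<open>K = \<gamma>\<^sub>1' \<gamma>\<^sub>2'' - \<gamma>\<^sub>1'' \<gamma>\<^sub>2'\<close>, the Gauss formula of \<open>\<phi>\<close> gives
  \<open>h = - K / W dt\<^sup>2 + \<epsilon>\<^sub>1 \<gamma>\<^sub>2 \<gamma>\<^sub>1' / W g\<close>, where \<open>g\<close> is the affine metric of \<open>\<phi>\<close>. Comparing volume forms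
  leads to \<open>\<gamma>\<^sub>2\<^sup>2 \<bar>W\<bar>\<^sup>5 = \<bar>K\<bar> \<gamma>\<^sub>1'\<^sup>2\<close>, and the sign condition on \<open>K\<close> says that the two coefficients of \<open>h\<close>
  have opposite signs.
\<close>

section \<open>Calculus of smooth maps\<close>

text \<open>The shape of \<xi> is dictated by the goal: if the shape operator is \<open>H\<close>
  times the identity, then \<xi> + H \<Phi> has zero derivative, so one looks for a constant vector,
  here \<open>c\<close> times the first basis vector. Modulo vectors tangent to \<phi>, all
  computations take place in the plane spanned by this basis vector and \<phi>, where \<xi> and the
  t-derivative of \<Phi> have the coordinates entering W. So W \<noteq> 0 means transversality, and
  Cramer's rule yields both coefficients of h; the mixed derivatives of \<Phi> are tangential, so
  there is no cross term. The obstacle is that g is merely a function on ambient vectors obeying the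
  Gauss formula. Its bilinearity on tangent planes must be extracted from that formula before Gram
  determinants can be expanded. Volume forms are compared on arbitrary tuples of tangent vectors;
  both sides, squared, carry the square of the same coordinate determinant, which leaves one
  identity for the coordinate frame, where the volume condition of \<phi> removes the determinant of
  g.\<close>

lemma Ck_on_cong:
  assumes "open U" and "\<And>u. u \<in> U \<Longrightarrow> f u = g u" and "Ck_on k U f"
  shows "Ck_on k U g"
  using assms
proof (induction k arbitrary: f g)
  case 0
  then show ?case by (simp cong: continuous_on_cong)
next
  case (Suc k)
  have der: "(g has_derivative frechet_derivative f (at u)) (at u)" if "u \<in> U" for u
  proof (rule has_derivative_transform_within_open[OF _ \<open>open U\<close> that])
    show "(f has_derivative frechet_derivative f (at u)) (at u)"
      using Suc.prems(3) that by (simp add: frechet_derivative_works)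
  qed (use Suc.prems(2) in blast)
  then have "frechet_derivative g (at u) = frechet_derivative f (at u)" if "u \<in> U" for u
    using that frechet_derivative_at by metis
  then have "Ck_on k U (\<lambda>u. frechet_derivative g (at u) a)" for a
    using Suc.IH[of "\<lambda>u. frechet_derivative f (at u) a"] \<open>open U\<close> Suc.prems(3) by simp
  with der show ?case
    by (auto simp: differentiable_def)
qed

text \<open>Lets the rules for \<open>has_derivative\<close> drive inductions on k: any family of
  derivatives may replace \<open>frechet_derivative\<close>, since derivatives at points of an open
  set are unique.\<close>

lemma Ck_on_SucI:
  assumes "open U"
    and der: "\<And>u. u \<in> U \<Longrightarrow> (f has_derivative f' u) (at u)"
    and Ck: "\<And>a. Ck_on k U (\<lambda>u. f' u a)"
  shows "Ck_on (Suc k) U f"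
proof -
  have eq: "f' u = frechet_derivative f (at u)" if "u \<in> U" for u
    using frechet_derivative_at[OF der[OF that]] by simp
  have "Ck_on k U (\<lambda>u. frechet_derivative f (at u) a)" for a
    by (rule Ck_on_cong[OF \<open>open U\<close> _ Ck[of a]]) (simp add: eq)
  then show ?thesis
    using der by (auto simp: differentiable_def)
qed

lemma Ck_on_SucD:
  assumes "Ck_on (Suc k) U f" and "u \<in> U"
  shows "(f has_derivative frechet_derivative f (at u)) (at u)"
  using assms by (simp add: frechet_derivative_works)

lemma Ck_on_Suc_imp: "Ck_on (Suc k) U f \<Longrightarrow> Ck_on k U f"
proof (induction k arbitrary: f)
  case 0
  then show ?case
    by (auto intro!: differentiable_imp_continuous_on simp: differentiable_on_def
        differentiable_at_withinI)
qed simp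

lemma Ck_on_subset: "Ck_on k U f \<Longrightarrow> V \<subseteq> U \<Longrightarrow> Ck_on k V f"
  by (induction k arbitrary: f) (auto intro: continuous_on_subset)

lemma Ck_on_const: "Ck_on k U (\<lambda>u. c)"
  by (induction k arbitrary: c) auto

lemma Ck_on_add:
  assumes "open U" "Ck_on k U f" "Ck_on k U g"
  shows "Ck_on k U (\<lambda>u. f u + g u)"
  using assms
proof (induction k arbitrary: f g)
  case (Suc k)
  show ?case
  proof (rule Ck_on_SucI[OF \<open>open U\<close>])
    show "((\<lambda>u. f u + g u) has_derivative
        (\<lambda>a. frechet_derivative f (at u) a + frechet_derivative g (at u) a)) (at u)"
      if "u \<in> U" for u
      using that Suc.prems by (intro has_derivative_add Ck_on_SucD)
  qed (use Suc \<open>open U\<close> in auto)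
qed (auto intro: continuous_on_add)

lemma Ck_on_linear_comp:
  assumes "bounded_linear L" "open U" "Ck_on k U f"
  shows "Ck_on k U (\<lambda>u. L (f u))"
  using assms
proof (induction k arbitrary: f)
  case 0
  then show ?case
    by (auto intro: bounded_linear.continuous_on)
next
  case (Suc k)
  show ?case
  proof (rule Ck_on_SucI[OF \<open>open U\<close>])
    show "((\<lambda>u. L (f u)) has_derivative (\<lambda>a. L (frechet_derivative f (at u) a))) (at u)"
      if "u \<in> U" for u
      using bounded_linear.has_derivative[OF \<open>bounded_linear L\<close> Ck_on_SucD] Suc.prems that by blast
  qed (use Suc \<open>open U\<close> in auto)
qed

text \<open>The inner map being linear, differentiation only replaces the direction \<open>a\<close>
  by \<open>L a\<close>, and the induction closes without a general chain rule. This suffices for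
  product charts, whose two projections are linear.\<close>

lemma Ck_on_comp_linear:
  assumes "bounded_linear L" "open U" "Ck_on k U f"
  shows "Ck_on k (L -` U) (\<lambda>u. f (L u))"
  using assms
proof (induction k arbitrary: f)
  case 0
  then show ?case
    using continuous_on_compose2[OF _ linear_continuous_on, of U f L "L -` U"] by simp
next
  case (Suc k)
  have "continuous_on UNIV L"
    by (rule linear_continuous_on[OF \<open>bounded_linear L\<close>])
  with \<open>open U\<close> have op: "open (L -` U)"
    by (simp add: open_vimage)
  show ?case
  proof (rule Ck_on_SucI[OF op])
    fix u assume u: "u \<in> L -` U"
    have "(f has_derivative frechet_derivative f (at (L u))) (at (L u))"
      using u Suc.prems by (intro Ck_on_SucD) auto
    from has_derivative_compose[OF bounded_linear_imp_has_derivative[OF \<open>bounded_linear L\<close>] this]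
    show "((\<lambda>u. f (L u)) has_derivative (\<lambda>a. frechet_derivative f (at (L u)) (L a))) (at u)" .
  qed (use Suc op in auto)
qed

lemma Ck_on_scaleR:
  fixes c :: "'a::real_normed_vector \<Rightarrow> real" and f :: "'a \<Rightarrow> 'b::real_normed_vector"
  assumes "open U" "Ck_on k U c" "Ck_on k U f"
  shows "Ck_on k U (\<lambda>u. c u *\<^sub>R f u)"
  using assms
proof (induction k arbitrary: c f)
  case (Suc k)
  show ?case
  proof (rule Ck_on_SucI[OF \<open>open U\<close>])
    show "((\<lambda>u. c u *\<^sub>R f u) has_derivative
        (\<lambda>a. c u *\<^sub>R frechet_derivative f (at u) a + frechet_derivative c (at u) a *\<^sub>R f u)) (at u)"
      if "u \<in> U" for u
      using that Suc.prems by (intro has_derivative_scaleR Ck_on_SucD)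
    show "Ck_on k U (\<lambda>u. c u *\<^sub>R frechet_derivative f (at u) a +
        frechet_derivative c (at u) a *\<^sub>R f u)" for a
      \<comment> \<open>The product rule keeps one factor undifferentiated, so each hypothesis is
        needed at level k as well.\<close>
      using Suc Ck_on_Suc_imp[OF Suc.prems(2)] Ck_on_Suc_imp[OF Suc.prems(3)]
      by (intro Ck_on_add) auto
  qed
qed (auto intro: continuous_on_scaleR)

lemma smooth_on_cong: "open U \<Longrightarrow> smooth_on U f \<Longrightarrow> (\<And>u. u \<in> U \<Longrightarrow> f u = g u) \<Longrightarrow> smooth_on U g"
  unfolding smooth_on_def using Ck_on_cong[of U f g] by auto

lemma smooth_on_const: "smooth_on U (\<lambda>u. c)"
  unfolding smooth_on_def by (simp add: Ck_on_const)

lemma smooth_on_add: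
  "open U \<Longrightarrow> smooth_on U f \<Longrightarrow> smooth_on U g \<Longrightarrow> smooth_on U (\<lambda>u. f u + g u)"
  unfolding smooth_on_def using Ck_on_add[of U _ f g] by auto

lemma smooth_on_scaleR:
  fixes c :: "'a::real_normed_vector \<Rightarrow> real"
  shows "open U \<Longrightarrow> smooth_on U c \<Longrightarrow> smooth_on U f \<Longrightarrow> smooth_on U (\<lambda>u. c u *\<^sub>R f u)"
  unfolding smooth_on_def using Ck_on_scaleR[of U _ c f] by auto

lemma smooth_on_linear_comp:
  "bounded_linear L \<Longrightarrow> open U \<Longrightarrow> smooth_on U f \<Longrightarrow> smooth_on U (\<lambda>u. L (f u))"
  unfolding smooth_on_def using Ck_on_linear_comp[of L U _ f] by auto

lemma smooth_on_comp_linear: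
  assumes "bounded_linear L" "open U" "smooth_on U f" "V \<subseteq> L -` U"
  shows "smooth_on V (\<lambda>u. f (L u))"
  using Ck_on_subset[OF Ck_on_comp_linear[OF assms(1,2)] assms(4)] assms(3)
  unfolding smooth_on_def by auto

lemma smooth_on_linear:
  assumes "bounded_linear L"
  shows "smooth_on U L"
  unfolding smooth_on_def
proof
  fix k
  show "Ck_on k U L"
  proof (cases k)
    case 0
    then show ?thesis by (simp add: linear_continuous_on[OF assms])
  next
    case (Suc m)
    have "Ck_on (Suc m) UNIV L"
      by (rule Ck_on_SucI[OF _ bounded_linear_imp_has_derivative[OF assms] Ck_on_const]) auto
    with Suc show ?thesis
      using Ck_on_subset[of k UNIV L U] by (simp del: Ck_on.simps)
  qed
qed

lemma smooth_on_has_derivative: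
  assumes "smooth_on U f" "u \<in> U"
  shows "(f has_derivative frechet_derivative f (at u)) (at u)"
  using assms Ck_on_SucD[of 0 U f u] unfolding smooth_on_def by (simp del: Ck_on.simps)

lemma smooth_on_frechet_derivative:
  assumes "smooth_on U f"
  shows "smooth_on U (\<lambda>u. frechet_derivative f (at u) a)"
  using assms Ck_on.simps(2)[of _ U f] unfolding smooth_on_def by (auto simp del: Ck_on.simps)

lemma smooth_on_imp_DERIV:
  fixes f :: "real \<Rightarrow> real"
  assumes "smooth_on U f" "t \<in> U"
  shows "(f has_real_derivative deriv f t) (at t)"
proof -
  have "f differentiable (at t)"
    using smooth_on_has_derivative[OF assms] differentiable_def by blast
  then show ?thesis
    by (simp add: DERIV_deriv_iff_real_differentiable)
qed

lemma smooth_on_deriv: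
  fixes f :: "real \<Rightarrow> real"
  assumes "open U" "smooth_on U f"
  shows "smooth_on U (deriv f)"
proof (rule smooth_on_cong[OF \<open>open U\<close> smooth_on_frechet_derivative[OF \<open>smooth_on U f\<close>]])
  fix t assume "t \<in> U"
  then have "(f has_derivative (*) (deriv f t)) (at t)"
    using smooth_on_imp_DERIV[OF assms(2)] by (simp add: has_field_derivative_def)
  then show "frechet_derivative f (at t) 1 = deriv f t"
    using frechet_derivative_at by (metis mult.right_neutral)
qed

section \<open>Manifolds and tangent spaces\<close>

lemma smooth_manifold_transition_open:
  assumes M: "smooth_manifold M \<A>" and x: "(U, x) \<in> \<A>" and y: "(V, y) \<in> \<A>"
  shows "open {u \<in> U. x u \<in> y ` V}"
proof -
  have U: "open U" and hom: "homeomorphic_map (top_of_set U) (subtopology M (x ` U)) x"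
    and V: "openin M (y ` V)"
    using M x y unfolding smooth_manifold_def by blast+
  have "openin (subtopology M (x ` U)) (y ` V \<inter> x ` U)"
    using V by (metis Int_commute openin_subtopology_Int2)
  moreover have "continuous_map (top_of_set U) (subtopology M (x ` U)) x"
    using hom homeomorphic_imp_continuous_map by blast
  ultimately have "openin (top_of_set U) {u \<in> topspace (top_of_set U). x u \<in> y ` V \<inter> x ` U}"
    using openin_continuous_map_preimage by blast
  moreover have "{u \<in> topspace (top_of_set U). x u \<in> y ` V \<inter> x ` U} = {u \<in> U. x u \<in> y ` V}"
    by auto
  ultimately show ?thesis
    using U by (simp add: openin_open_eq)
qed

lemma smooth_manifold_chart_inj:
  assumes "smooth_manifold M \<A>" and "(U, x) \<in> \<A>"
  shows "inj_on x U"
proof -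
  have "homeomorphic_map (top_of_set U) (subtopology M (x ` U)) x"
    using assms unfolding smooth_manifold_def by blast
  then show ?thesis
    using homeomorphic_map_def by (metis topspace_euclidean_subtopology)
qed

text \<open>Near \<open>u\<close> the map \<open>\<phi> \<circ> x\<close> is
  \<open>\<phi> \<circ> y\<close> after the transition map, so by the chain rule its derivative
  factors through that of \<open>\<phi> \<circ> y\<close>.\<close>

lemma range_derivative_chart_subset:
  assumes M: "smooth_manifold M \<A>" and f: "smooth_map \<A> \<phi>"
    and x: "(U, x) \<in> \<A>" "u \<in> U" and y: "(V, y) \<in> \<A>" "v \<in> V" and eq: "x u = y v"
  shows "range (frechet_derivative (\<phi> \<circ> x) (at u)) \<subseteq> range (frechet_derivative (\<phi> \<circ> y) (at v))"
proof -
  define \<tau> where "\<tau> = inv_into V y \<circ> x"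
  define W where "W = {u \<in> U. x u \<in> y ` V}"
  have W: "open W" "u \<in> W"
    using smooth_manifold_transition_open[OF M x(1) y(1)] x y eq by (auto simp: W_def)
  have "smooth_on W \<tau>"
    using M x y unfolding smooth_manifold_def W_def \<tau>_def by blast
  then have \<tau>: "(\<tau> has_derivative frechet_derivative \<tau> (at u)) (at u)"
    using W smooth_on_has_derivative by blast
  have \<tau>u: "\<tau> u = v"
    using smooth_manifold_chart_inj[OF M y(1)] y eq by (simp add: \<tau>_def)
  have "(\<phi> \<circ> y has_derivative frechet_derivative (\<phi> \<circ> y) (at v)) (at (\<tau> u))"
    using f y smooth_on_has_derivative unfolding \<tau>u smooth_map_def by blast
  from diff_chain_at[OF \<tau> this]
  have "((\<phi> \<circ> y) \<circ> \<tau> has_derivative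
      frechet_derivative (\<phi> \<circ> y) (at v) \<circ> frechet_derivative \<tau> (at u)) (at u)" .
  then have "(\<phi> \<circ> x has_derivative
      frechet_derivative (\<phi> \<circ> y) (at v) \<circ> frechet_derivative \<tau> (at u)) (at u)"
    by (rule has_derivative_transform_within_open[OF _ W])
      (auto simp: W_def \<tau>_def f_inv_into_f)
  then have "frechet_derivative (\<phi> \<circ> x) (at u) =
      frechet_derivative (\<phi> \<circ> y) (at v) \<circ> frechet_derivative \<tau> (at u)"
    using frechet_derivative_at by metis
  then show ?thesis
    by (simp add: image_subset_iff)
qed

text \<open>The definition collects vectors from all charts at the point. That one chart suffices
  makes the tangent space a linear subspace.\<close>

lemma tangent_space_eq_range:
  assumes "smooth_manifold M \<A>" "smooth_map \<A> \<phi>" "(U, x) \<in> \<A>" "u \<in> U"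
  shows "tangent_space \<A> \<phi> (x u) = range (frechet_derivative (\<phi> \<circ> x) (at u))"
proof
  show "range (frechet_derivative (\<phi> \<circ> x) (at u)) \<subseteq> tangent_space \<A> \<phi> (x u)"
    using assms(3,4) unfolding tangent_space_def by blast
  show "tangent_space \<A> \<phi> (x u) \<subseteq> range (frechet_derivative (\<phi> \<circ> x) (at u))"
  proof
    fix X assume "X \<in> tangent_space \<A> \<phi> (x u)"
    then obtain V y v a where "(V, y) \<in> \<A>" "v \<in> V" "y v = x u"
      and X: "X = frechet_derivative (\<phi> \<circ> y) (at v) a"
      unfolding tangent_space_def by auto
    then have "range (frechet_derivative (\<phi> \<circ> y) (at v)) \<subseteq> range (frechet_derivative (\<phi> \<circ> x) (at u))"
      using assms by (intro range_derivative_chart_subset)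
    then show "X \<in> range (frechet_derivative (\<phi> \<circ> x) (at u))"
      using X by blast
  qed
qed

section \<open>Countable bases of products and of subsets of Euclidean space\<close>

lemma second_countable_prod_topology:
  assumes "second_countable X" and "second_countable Y"
  shows "second_countable (prod_topology X Y)"
proof -
  obtain \<B> where \<B>: "countable \<B>" "\<And>V. V \<in> \<B> \<Longrightarrow> openin X V"
    "\<And>U x. openin X U \<and> x \<in> U \<longrightarrow> (\<exists>V \<in> \<B>. x \<in> V \<and> V \<subseteq> U)"
    using assms(1) by (auto simp: second_countable_def)
  obtain \<C> where \<C>: "countable \<C>" "\<And>V. V \<in> \<C> \<Longrightarrow> openin Y V"
    "\<And>U x. openin Y U \<and> x \<in> U \<longrightarrow> (\<exists>V \<in> \<C>. x \<in> V \<and> V \<subseteq> U)"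
    using assms(2) by (auto simp: second_countable_def)
  show ?thesis
    unfolding second_countable_def
  proof (intro exI[of _ "(\<lambda>(A, B). A \<times> B) ` (\<B> \<times> \<C>)"] conjI allI impI)
    show "countable ((\<lambda>(A, B). A \<times> B) ` (\<B> \<times> \<C>))"
      using \<B>(1) \<C>(1) by simp
    show "\<forall>V\<in>(\<lambda>(A, B). A \<times> B) ` (\<B> \<times> \<C>). openin (prod_topology X Y) V"
      using \<B>(2) \<C>(2) by (auto simp: openin_prod_Times_iff)
  next
    fix U z assume U: "openin (prod_topology X Y) U \<and> z \<in> U"
    obtain x y where z: "z = (x, y)"
      by (cases z)
    obtain S T where "openin X S" "openin Y T" "x \<in> S" "y \<in> T" and ST: "S \<times> T \<subseteq> U"
      using U unfolding z openin_prod_topology_alt by blast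
    then obtain A B where "A \<in> \<B>" "x \<in> A" "A \<subseteq> S" "B \<in> \<C>" "y \<in> B" "B \<subseteq> T"
      using \<B>(3)[of S x] \<C>(3)[of T y] by blast
    then have "A \<times> B \<in> (\<lambda>(A, B). A \<times> B) ` (\<B> \<times> \<C>)" and "z \<in> A \<times> B" and "A \<times> B \<subseteq> U"
      using ST unfolding z by auto
    then show "\<exists>V\<in>(\<lambda>(A, B). A \<times> B) ` (\<B> \<times> \<C>). z \<in> V \<and> V \<subseteq> U"
      by blast
  qed
qed

lemma second_countable_top_of_set:
  fixes S :: "'a::second_countable_topology set"
  shows "second_countable (top_of_set S)"
proof -
  obtain \<B> :: "'a set set" where "countable \<B>" "topological_basis \<B>"
    using ex_countable_basis by blast
  then have "second_countable (euclidean :: 'a topology)"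
    unfolding second_countable_def
    by (metis open_openin topological_basisE topological_basis_open)
  then show ?thesis
    by (rule second_countable_subtopology)
qed

section \<open>The product of an interval and a surface\<close>

definition tl_vec :: "real^3 \<Rightarrow> real^2"
  where "tl_vec u = vector [u $ 2, u $ 3]"

definition cons_vec :: "real \<Rightarrow> real^2 \<Rightarrow> real^3"
  where "cons_vec t v = vector [t, v $ 1, v $ 2]"

lemma tl_vec_nth [simp]: "tl_vec u $ 1 = u $ 2" "tl_vec u $ 2 = u $ 3"
  by (simp_all add: tl_vec_def)

lemma cons_vec_nth [simp]:
  "cons_vec t v $ 1 = t" "cons_vec t v $ 2 = v $ 1" "cons_vec t v $ 3 = v $ 2"
  by (simp_all add: cons_vec_def)

lemma tl_vec_cons_vec [simp]: "tl_vec (cons_vec t v) = v"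
  by (simp add: vec_eq_iff forall_2)

lemma cons_vec_tl_vec [simp]: "cons_vec (u $ 1) (tl_vec u) = u"
  by (simp add: vec_eq_iff forall_3)

lemma eq_vec_3_iff: "u = v \<longleftrightarrow> u $ 1 = v $ 1 \<and> tl_vec u = tl_vec v"
  by (metis cons_vec_tl_vec)

lemma bounded_linear_tl_vec: "bounded_linear tl_vec"
  by (intro linear_conv_bounded_linear[THEN iffD1] linearI) (simp_all add: vec_eq_iff forall_2)

lemma bounded_linear_cons_vec: "bounded_linear (\<lambda>(t, v). cons_vec t v)"
  by (intro linear_conv_bounded_linear[THEN iffD1] linearI)
    (auto simp: vec_eq_iff forall_3)

definition interval_times :: "real set \<Rightarrow> (real^2) set \<Rightarrow> (real^3) set"
  where "interval_times I U = {u. u $ 1 \<in> I \<and> tl_vec u \<in> U}"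

definition interval_times_chart :: "(real^2 \<Rightarrow> 'p) \<Rightarrow> real^3 \<Rightarrow> real \<times> 'p"
  where "interval_times_chart x u = (u $ 1, x (tl_vec u))"

lemma mem_interval_times [simp]: "u \<in> interval_times I U \<longleftrightarrow> u $ 1 \<in> I \<and> tl_vec u \<in> U"
  by (simp add: interval_times_def)

lemma interval_times_chart_eq [simp]:
  "interval_times_chart x u = (t, q) \<longleftrightarrow> u $ 1 = t \<and> x (tl_vec u) = q"
  by (auto simp: interval_times_chart_def)

lemma interval_times_atlas_eq:
  "interval_times_atlas I \<A> = (\<lambda>(U, x). (interval_times I U, interval_times_chart x)) ` \<A>"
  unfolding interval_times_atlas_def interval_times_def interval_times_chart_def tl_vec_def ..

lemma open_interval_times:
  assumes "open I" "open U"
  shows "open (interval_times I U)"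
proof -
  have "interval_times I U = (\<lambda>u. u $ 1) -` I \<inter> tl_vec -` U"
    by (auto simp: interval_times_def)
  moreover have "open ((\<lambda>u::real^3. u $ 1) -` I)"
    using assms(1) by (intro open_vimage) (auto intro: continuous_intros)
  moreover have "open (tl_vec -` U)"
    using assms(2) linear_continuous_on[OF bounded_linear_tl_vec] by (intro open_vimage) auto
  ultimately show ?thesis
    by auto
qed

lemma image_interval_times_chart:
  "interval_times_chart x ` interval_times I U = I \<times> x ` U"
proof
  show "I \<times> x ` U \<subseteq> interval_times_chart x ` interval_times I U"
  proof clarify
    fix t u assume "t \<in> I" "u \<in> U"
    then have "cons_vec t u \<in> interval_times I U"
      and "interval_times_chart x (cons_vec t u) = (t, x u)"
      by auto
    then show "(t, x u) \<in> interval_times_chart x ` interval_times I U"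
      by (metis imageI)
  qed
qed (auto simp: interval_times_chart_def)

text \<open>The chart is the linear splitting of \<open>real^3\<close> into \<open>real\<close> and
  \<open>real^2\<close>, followed by the product of the identity with \<open>x\<close>; both factors
  are homeomorphisms.\<close>

lemma homeomorphic_map_interval_times_chart:
  assumes x: "homeomorphic_map (top_of_set U) (subtopology N (x ` U)) x"
  shows "homeomorphic_map (top_of_set (interval_times I U))
    (subtopology (prod_topology (top_of_set I) N) (I \<times> x ` U)) (interval_times_chart x)"
proof -
  have "homeomorphic_maps (top_of_set (interval_times I U)) (top_of_set (I \<times> U))
      (\<lambda>u. (u $ 1, tl_vec u)) (\<lambda>(t, v). cons_vec t v)"
    unfolding homeomorphic_maps_def
    using linear_continuous_on[OF bounded_linear_tl_vec] linear_continuous_on[OF bounded_linear_cons_vec]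
    by (auto simp: continuous_map_in_subtopology intro!: continuous_intros)
  then have 1: "homeomorphic_map (top_of_set (interval_times I U))
      (prod_topology (top_of_set I) (top_of_set U)) (\<lambda>u. (u $ 1, tl_vec u))"
    unfolding prod_topology_subtopology_eu homeomorphic_map_maps by blast
  obtain x' where x': "homeomorphic_maps (top_of_set U) (subtopology N (x ` U)) x x'"
    using x homeomorphic_map_maps by blast
  have "homeomorphic_maps (prod_topology (top_of_set I) (top_of_set U))
      (prod_topology (top_of_set I) (subtopology N (x ` U))) (\<lambda>(t, v). (t, x v)) (\<lambda>(t, q). (t, x' q))"
    by (intro homeomorphic_maps_prod[THEN iffD2] disjI2 conjI x') (simp add: homeomorphic_maps_def)
  moreover have "prod_topology (top_of_set I) (subtopology N (x ` U)) =
      subtopology (prod_topology (top_of_set I) N) (I \<times> x ` U)"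
    by (simp add: subtopology_Times subtopology_subtopology)
  ultimately have "homeomorphic_map (prod_topology (top_of_set I) (top_of_set U))
      (subtopology (prod_topology (top_of_set I) N) (I \<times> x ` U)) (\<lambda>(t, v). (t, x v))"
    using homeomorphic_map_maps by metis
  from homeomorphic_map_compose[OF 1 this] show ?thesis
    by (simp add: o_def interval_times_chart_def[abs_def])
qed

lemma interval_times_transition:
  assumes inj: "inj_on y V" and u: "u $ 1 \<in> I" "x (tl_vec u) \<in> y ` V"
  shows "inv_into (interval_times I V) (interval_times_chart y) (interval_times_chart x u) =
    cons_vec (u $ 1) (inv_into V y (x (tl_vec u)))"
proof (rule inv_into_f_eq)
  show "inj_on (interval_times_chart y) (interval_times I V)"
    using inj by (auto simp: inj_on_def interval_times_chart_def eq_vec_3_iff)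
  show "cons_vec (u $ 1) (inv_into V y (x (tl_vec u))) \<in> interval_times I V"
    using u by (auto intro: inv_into_into)
  show "interval_times_chart y (cons_vec (u $ 1) (inv_into V y (x (tl_vec u)))) =
      interval_times_chart x u"
    using u by (simp add: interval_times_chart_def f_inv_into_f)
qed

lemma smooth_on_interval_times_transition:
  assumes "open I" and N: "smooth_manifold N \<A>" and x: "(U, x) \<in> \<A>" and y: "(V, y) \<in> \<A>"
  shows "smooth_on
    {u \<in> interval_times I U. interval_times_chart x u \<in> interval_times_chart y ` interval_times I V}
    (inv_into (interval_times I V) (interval_times_chart y) \<circ> interval_times_chart x)"
proof -
  define W where "W = {u \<in> U. x u \<in> y ` V}"
  have W: "open W"
    unfolding W_def using N x y by (rule smooth_manifold_transition_open)
  have dom: "{u \<in> interval_times I U. interval_times_chart x u \<in>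
      interval_times_chart y ` interval_times I V} = interval_times I W"
    unfolding image_interval_times_chart by (auto simp: W_def interval_times_chart_def)
  have op: "open (interval_times I W)"
    using \<open>open I\<close> W by (rule open_interval_times)
  \<comment> \<open>The transition map is the identity in t times the transition map of N. Writing
    it as the linear map \<open>L\<close> plus a linear image of the latter reduces smoothness to
    sums and linear compositions.\<close>
  define L where "L u = cons_vec (u $ 1) 0" for u :: "real^3"
  have L: "bounded_linear L" and cons: "bounded_linear (cons_vec 0)"
    unfolding L_def
    by (intro linear_conv_bounded_linear[THEN iffD1] linearI; simp add: vec_eq_iff forall_3)+
  have "smooth_on W (inv_into V y \<circ> x)"
    using N x y unfolding smooth_manifold_def W_def by blast
  then have "smooth_on (interval_times I W) (\<lambda>u. (inv_into V y \<circ> x) (tl_vec u))"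
    by (rule smooth_on_comp_linear[OF bounded_linear_tl_vec W]) auto
  then have "smooth_on (interval_times I W) (\<lambda>u. L u + cons_vec 0 ((inv_into V y \<circ> x) (tl_vec u)))"
    by (intro smooth_on_add[OF op] smooth_on_linear[OF L] smooth_on_linear_comp[OF cons op])
  then show ?thesis
    unfolding dom
  proof (rule smooth_on_cong[OF op])
    fix u assume "u \<in> interval_times I W"
    then show "L u + cons_vec 0 ((inv_into V y \<circ> x) (tl_vec u)) =
        (inv_into (interval_times I V) (interval_times_chart y) \<circ> interval_times_chart x) u"
      using smooth_manifold_chart_inj[OF N y]
      by (simp add: W_def interval_times_transition L_def vec_eq_iff forall_3)
  qed
qed

lemma smooth_manifold_interval_times:
  assumes "open I" and N: "smooth_manifold N \<A>"
  shows "smooth_manifold (prod_topology (top_of_set I) N) (interval_times_atlas I \<A>)"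
  unfolding smooth_manifold_def
proof (intro conjI)
  show "Hausdorff_space (prod_topology (top_of_set I) N)"
    using N Hausdorff_space_subtopology[OF Hausdorff_space_euclidean]
    by (auto simp: Hausdorff_space_prod_topology smooth_manifold_def)
  show "second_countable (prod_topology (top_of_set I) N)"
    using N second_countable_top_of_set
    by (auto intro: second_countable_prod_topology simp: smooth_manifold_def)
  have "(\<Union>(U, x)\<in>interval_times_atlas I \<A>. x ` U) = (\<Union>(U, x)\<in>\<A>. I \<times> x ` U)"
    by (simp add: interval_times_atlas_eq image_interval_times_chart case_prod_beta)
  also have "\<dots> = I \<times> (\<Union>(U, x)\<in>\<A>. x ` U)"
    by auto
  also have "\<dots> = topspace (prod_topology (top_of_set I) N)"
    using N by (simp add: smooth_manifold_def)
  finally show "(\<Union>(U, x)\<in>interval_times_atlas I \<A>. x ` U) =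
      topspace (prod_topology (top_of_set I) N)" .
  show "\<forall>(U, x)\<in>interval_times_atlas I \<A>.
      open U \<and> openin (prod_topology (top_of_set I) N) (x ` U) \<and>
      homeomorphic_map (top_of_set U) (subtopology (prod_topology (top_of_set I) N) (x ` U)) x"
  proof clarify
    fix U' x' assume "(U', x') \<in> interval_times_atlas I \<A>"
    then obtain U x where x: "(U, x) \<in> \<A>"
      and eq: "U' = interval_times I U" "x' = interval_times_chart x"
      by (auto simp: interval_times_atlas_eq)
    have "open U" "openin N (x ` U)" "homeomorphic_map (top_of_set U) (subtopology N (x ` U)) x"
      using N x by (auto simp: smooth_manifold_def)
    then show "open U' \<and> openin (prod_topology (top_of_set I) N) (x' ` U') \<and>
        homeomorphic_map (top_of_set U') (subtopology (prod_topology (top_of_set I) N) (x' ` U')) x'"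
      unfolding eq image_interval_times_chart
      using \<open>open I\<close> by (simp add: open_interval_times openin_prod_Times_iff
          homeomorphic_map_interval_times_chart)
  qed
  show "\<forall>(U, x)\<in>interval_times_atlas I \<A>. \<forall>(V, y)\<in>interval_times_atlas I \<A>.
      smooth_on {u \<in> U. x u \<in> y ` V} (inv_into V y \<circ> x)"
    using smooth_on_interval_times_transition[OF \<open>open I\<close> N]
    by (auto simp: interval_times_atlas_eq)
qed

section \<open>Determinants and coordinates of \<open>\<real>\<^sup>4\<close>\<close>

lemma det_4:
  "det (A::'a::comm_ring_1^4^4) =
    A$1$1 * (A$2$2 * A$3$3 * A$4$4 + A$2$3 * A$3$4 * A$4$2 + A$2$4 * A$3$2 * A$4$3
      - A$2$2 * A$3$4 * A$4$3 - A$2$3 * A$3$2 * A$4$4 - A$2$4 * A$3$3 * A$4$2)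
  - A$1$2 * (A$2$1 * A$3$3 * A$4$4 + A$2$3 * A$3$4 * A$4$1 + A$2$4 * A$3$1 * A$4$3
      - A$2$1 * A$3$4 * A$4$3 - A$2$3 * A$3$1 * A$4$4 - A$2$4 * A$3$3 * A$4$1)
  + A$1$3 * (A$2$1 * A$3$2 * A$4$4 + A$2$2 * A$3$4 * A$4$1 + A$2$4 * A$3$1 * A$4$2
      - A$2$1 * A$3$4 * A$4$2 - A$2$2 * A$3$1 * A$4$4 - A$2$4 * A$3$2 * A$4$1)
  - A$1$4 * (A$2$1 * A$3$2 * A$4$3 + A$2$2 * A$3$3 * A$4$1 + A$2$3 * A$3$1 * A$4$2
      - A$2$1 * A$3$3 * A$4$2 - A$2$2 * A$3$1 * A$4$3 - A$2$3 * A$3$2 * A$4$1)"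
proof -
  have f1: "finite {2::4, 3, 4}" "1 \<notin> {2::4, 3, 4}"
    and f2: "finite {3::4, 4}" "2 \<notin> {3::4, 4}"
    and f3: "finite {4::4}" "3 \<notin> {4::4}"
    by auto
  show ?thesis
    unfolding det_def UNIV_4 sum_over_permutations_insert[OF f1]
      sum_over_permutations_insert[OF f2] sum_over_permutations_insert[OF f3] permutes_sing
    by (simp add: sign_swap_id permutation_swap_id permutation_compose sign_compose sign_id
        swap_id_eq algebra_simps)
qed

text \<open>Two enumerations differ by a permutation of the rows, which only affects the sign. A
  volume comparison may therefore use one fixed enumeration.\<close>

lemma abs_det_row_enumeration:
  fixes R :: "'n option \<Rightarrow> real^'m::finite" and e e' :: "'m \<Rightarrow> 'n option"
  assumes "bij e" "bij e'"
  shows "\<bar>det (\<chi> k. R (e k))\<bar> = \<bar>det (\<chi> k. R (e' k))\<bar>"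
proof -
  define p where "p = inv e' \<circ> e"
  have "bij p"
    unfolding p_def using assms by (intro bij_comp bij_imp_bij_inv)
  then have p: "p permutes UNIV"
    by (rule bij_imp_permutes) simp
  have eq: "e k = e' (p k)" for k
    using assms by (simp add: p_def surj_f_inv_f bij_is_surj)
  have "det (\<chi> k. R (e k)) = of_int (sign p) * det (\<chi> k. R (e' k))"
    using det_permute_rows[OF p, of "\<chi> k. R (e' k)"] by (simp add: eq)
  then show ?thesis
    by (simp add: abs_mult sign_def)
qed

section \<open>Splitting 4-space into the axis of the curve and the space containing the
  surface\<close>

definition cons_vec4 :: "real \<Rightarrow> real^3 \<Rightarrow> real^4"
  where "cons_vec4 r v = vector [r, v $ 1, v $ 2, v $ 3]"

definition tl_vec4 :: "real^4 \<Rightarrow> real^3"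
  where "tl_vec4 u = vector [u $ 2, u $ 3, u $ 4]"

lemma vector_4 [simp]:
  "(vector [x, y, z, w] :: ('a::zero)^4) $ 1 = x"
  "(vector [x, y, z, w] :: ('a::zero)^4) $ 2 = y"
  "(vector [x, y, z, w] :: ('a::zero)^4) $ 3 = z"
  "(vector [x, y, z, w] :: ('a::zero)^4) $ 4 = w"
  unfolding vector_def by simp_all

lemma cons_vec4_nth [simp]:
  "cons_vec4 r v $ 1 = r" "cons_vec4 r v $ 2 = v $ 1"
  "cons_vec4 r v $ 3 = v $ 2" "cons_vec4 r v $ 4 = v $ 3"
  by (simp_all add: cons_vec4_def)

lemma tl_vec4_cons_vec4 [simp]: "tl_vec4 (cons_vec4 r v) = v"
  by (simp add: tl_vec4_def vec_eq_iff forall_3)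

lemma cons_vec4_inject [simp]: "cons_vec4 r v = cons_vec4 s w \<longleftrightarrow> r = s \<and> v = w"
  by (metis cons_vec4_nth(1) tl_vec4_cons_vec4)

lemma cons_vec4_add: "cons_vec4 r v + cons_vec4 s w = cons_vec4 (r + s) (v + w)"
  by (simp add: vec_eq_iff forall_4)

lemma cons_vec4_scaleR: "a *\<^sub>R cons_vec4 r v = cons_vec4 (a * r) (a *\<^sub>R v)"
  by (simp add: vec_eq_iff forall_4)

lemma cons_vec4_zero: "cons_vec4 0 0 = 0"
  by (simp add: vec_eq_iff forall_4)

lemma bounded_linear_cons_vec4: "bounded_linear (\<lambda>(r, v). cons_vec4 r v)"
  by (intro linear_conv_bounded_linear[THEN iffD1] linearI)
    (auto simp: vec_eq_iff forall_4)

lemma has_derivative_cons_vec4: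
  assumes "(f has_derivative f') (at x within S)" "(g has_derivative g') (at x within S)"
  shows "((\<lambda>u. cons_vec4 (f u) (g u)) has_derivative (\<lambda>a. cons_vec4 (f' a) (g' a))) (at x within S)"
  using bounded_linear.has_derivative[OF bounded_linear_cons_vec4 has_derivative_Pair[OF assms]]
  by simp

lemma smooth_on_cons_vec4:
  assumes "open U" "smooth_on U f" "smooth_on U g"
  shows "smooth_on U (\<lambda>u. cons_vec4 (f u) (g u))"
proof -
  have 1: "bounded_linear (\<lambda>r. cons_vec4 r 0)" and 2: "bounded_linear (cons_vec4 0)"
    by (intro linear_conv_bounded_linear[THEN iffD1] linearI; simp add: vec_eq_iff forall_4)+
  have "smooth_on U (\<lambda>u. cons_vec4 (f u) 0 + cons_vec4 0 (g u))"
    using smooth_on_add[OF assms(1) smooth_on_linear_comp[OF 1 assms(1,2)]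
        smooth_on_linear_comp[OF 2 assms(1,3)]] .
  then show ?thesis
    by (simp add: cons_vec4_add)
qed

lemma warped_immersion_eq:
  "warped_immersion \<gamma>1 \<gamma>2 \<phi> (t, p) = cons_vec4 (\<gamma>1 t) (\<gamma>2 t *\<^sub>R \<phi> p)"
  by (simp add: warped_immersion_def cons_vec4_def)

text \<open>A change of frame: the matrix of coordinates, bordered by a unit row and column that
  keep \<open>n\<close> fixed, multiplies the matrix of the frame. It reduces arbitrary tangent
  vectors to the coordinate frame.\<close>

lemma det_rows_block:
  fixes r :: "3 \<Rightarrow> real" and w :: "3 \<Rightarrow> real^2" and T0 T1 T2 n :: "real^4"
  shows "det (vector [r 1 *\<^sub>R T0 + (w 1 $ 1) *\<^sub>R T1 + (w 1 $ 2) *\<^sub>R T2,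
      r 2 *\<^sub>R T0 + (w 2 $ 1) *\<^sub>R T1 + (w 2 $ 2) *\<^sub>R T2,
      r 3 *\<^sub>R T0 + (w 3 $ 1) *\<^sub>R T1 + (w 3 $ 2) *\<^sub>R T2, n] :: real^4^4) =
    det (\<chi> i. cons_vec (r i) (w i)) * det (vector [T0, T1, T2, n] :: real^4^4)"
proof -
  define P :: "real^4^4" where "P = vector [vector [r 1, w 1 $ 1, w 1 $ 2, 0],
    vector [r 2, w 2 $ 1, w 2 $ 2, 0], vector [r 3, w 3 $ 1, w 3 $ 2, 0], vector [0, 0, 0, 1]]"
  have "vector [r 1 *\<^sub>R T0 + (w 1 $ 1) *\<^sub>R T1 + (w 1 $ 2) *\<^sub>R T2,
      r 2 *\<^sub>R T0 + (w 2 $ 1) *\<^sub>R T1 + (w 2 $ 2) *\<^sub>R T2,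
      r 3 *\<^sub>R T0 + (w 3 $ 1) *\<^sub>R T1 + (w 3 $ 2) *\<^sub>R T2, n] = P ** vector [T0, T1, T2, n]"
    by (simp add: vec_eq_iff forall_4 matrix_matrix_mult_def sum_4 P_def)
  moreover have "det P = det (\<chi> i. cons_vec (r i) (w i))"
    unfolding det_4 det_3 P_def by (simp add: algebra_simps)
  ultimately show ?thesis
    by (simp add: det_mul)
qed

text \<open>The Gram counterpart of the change of frame: the matrix is
  \<open>M ** G ** transpose M\<close> with \<open>G\<close> block diagonal, so the same coordinate
  determinant appears squared.\<close>

lemma det_gram_block:
  fixes r :: "3 \<Rightarrow> real" and w :: "3 \<Rightarrow> real^2" and \<alpha> \<beta> :: real and g :: "2 \<Rightarrow> 2 \<Rightarrow> real"
  shows "det (\<chi> i j. \<alpha> * (r i * r j) + \<beta> * (\<Sum>k\<in>UNIV. \<Sum>l\<in>UNIV. w i $ k * w j $ l * g k l) :: real^3^3) =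
    (det (\<chi> i. cons_vec (r i) (w i)))\<^sup>2 * (\<alpha> * \<beta>\<^sup>2 * (g 1 1 * g 2 2 - g 1 2 * g 2 1))"
proof -
  define M :: "real^3^3" where "M = (\<chi> i. cons_vec (r i) (w i))"
  define G :: "real^3^3" where "G = vector [vector [\<alpha>, 0, 0],
    vector [0, \<beta> * g 1 1, \<beta> * g 1 2], vector [0, \<beta> * g 2 1, \<beta> * g 2 2]]"
  have "(\<chi> i j. \<alpha> * (r i * r j) + \<beta> * (\<Sum>k\<in>UNIV. \<Sum>l\<in>UNIV. w i $ k * w j $ l * g k l)) =
      M ** G ** transpose M"
    by (simp add: vec_eq_iff matrix_matrix_mult_def sum_3 sum_2 M_def G_def transpose_def
        algebra_simps)
  moreover have "det G = \<alpha> * \<beta>\<^sup>2 * (g 1 1 * g 2 2 - g 1 2 * g 2 1)"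
    unfolding det_3 G_def by (simp add: algebra_simps power2_eq_square)
  ultimately show ?thesis
    by (simp add: det_mul det_transpose M_def[symmetric] power2_eq_square)
qed

text \<open>After elimination only the 2 by 2 determinant in the plane of the first axis and \<phi>
  remains. For the t-derivative of \<Phi> and for \<xi> it equals -W.\<close>

lemma det_frame:
  fixes e1 e2 \<phi> :: "real^3" and a b c d \<eta> :: real
  shows "det (vector [cons_vec4 a (b *\<^sub>R \<phi>), cons_vec4 0 (d *\<^sub>R e1), cons_vec4 0 (d *\<^sub>R e2),
      cons_vec4 c (\<eta> *\<^sub>R \<phi>)] :: real^4^4) =
    (a * \<eta> - b * c) * d\<^sup>2 * det (vector [e1, e2, \<phi>] :: real^3^3)"
  unfolding det_4 det_3 by (simp add: algebra_simps power2_eq_square)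

section \<open>Centroaffine surfaces\<close>

text \<open>Treats elliptic and hyperbolic spheres together: in both cases the position vector is
  the affine normal up to sign, so 3-space splits at each point into the tangent plane and the line
  of \<phi>.\<close>

locale centroaffine_surface =
  fixes N :: "'p topology" and \<A> :: "(2, 'p) atlas" and \<phi> :: "'p \<Rightarrow> real^3"
    and \<epsilon> H0 :: real and g :: "'p \<Rightarrow> real^3 \<Rightarrow> real^3 \<Rightarrow> real"
  assumes eps: "\<epsilon> = 1 \<or> \<epsilon> = -1"
    and sphere: "affine_sphere N \<A> \<phi> (\<lambda>p. - \<epsilon> *\<^sub>R \<phi> p) g H0"
    and posdef: "positive_definite_metric N \<A> \<phi> g"
begin

abbreviation T :: "'p \<Rightarrow> (real^3) set"
  where "T \<equiv> tangent_space \<A> \<phi>"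

abbreviation D :: "(real^2 \<Rightarrow> 'p) \<Rightarrow> real^2 \<Rightarrow> real^2 \<Rightarrow> real^3"
  where "D x u \<equiv> frechet_derivative (\<phi> \<circ> x) (at u)"

lemma manifold: "smooth_manifold N \<A>"
  and smooth: "smooth_map \<A> \<phi>"
  and trans: "p \<in> topspace N \<Longrightarrow> - \<epsilon> *\<^sub>R \<phi> p \<notin> T p"
  and gauss: "gauss_formula \<A> \<phi> (\<lambda>p. - \<epsilon> *\<^sub>R \<phi> p) g"
  and vol: "equal_volume_forms N \<A> \<phi> (\<lambda>p. - \<epsilon> *\<^sub>R \<phi> p) g"
  using sphere
  unfolding affine_sphere_def affine_normal_def immersed_hypersurface_def transversal_field_def
  by auto

lemma inj_D: "(U, x) \<in> \<A> \<Longrightarrow> u \<in> U \<Longrightarrow> inj (D x u)"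
  using sphere
  unfolding affine_sphere_def affine_normal_def immersed_hypersurface_def by auto

lemma chart_exists:
  assumes "q \<in> topspace N"
  obtains U x u where "(U, x) \<in> \<A>" "u \<in> U" "x u = q"
proof -
  have "q \<in> (\<Union>(U, x)\<in>\<A>. x ` U)"
    using assms manifold by (simp add: smooth_manifold_def)
  then show thesis
    using that by auto
qed

lemma chart_in_topspace: "(U, x) \<in> \<A> \<Longrightarrow> u \<in> U \<Longrightarrow> x u \<in> topspace N"
  using manifold unfolding smooth_manifold_def by auto

lemma smooth_chart: "(U, x) \<in> \<A> \<Longrightarrow> smooth_on U (\<phi> \<circ> x)"
  using smooth unfolding smooth_map_def by auto

lemma open_chart: "(U, x) \<in> \<A> \<Longrightarrow> open U"
  using manifold unfolding smooth_manifold_def by auto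

lemma has_derivative_D: "(U, x) \<in> \<A> \<Longrightarrow> u \<in> U \<Longrightarrow> (\<phi> \<circ> x has_derivative D x u) (at u)"
  using smooth_chart smooth_on_has_derivative by blast

lemma linear_D: "(U, x) \<in> \<A> \<Longrightarrow> u \<in> U \<Longrightarrow> linear (D x u)"
  using has_derivative_D has_derivative_linear by blast

lemma T_eq: "(U, x) \<in> \<A> \<Longrightarrow> u \<in> U \<Longrightarrow> T (x u) = range (D x u)"
  using tangent_space_eq_range[OF manifold smooth] .

lemma subspace_T:
  assumes "q \<in> topspace N"
  shows "subspace (T q)"
proof -
  obtain U x u where "(U, x) \<in> \<A>" "u \<in> U" "x u = q"
    using assms by (rule chart_exists)
  then show ?thesis
    using T_eq linear_D linear_subspace_image[OF _ subspace_UNIV] by metis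
qed

text \<open>Two different coefficients would put a nonzero multiple of \<phi>, hence the affine
  normal, into the tangent plane. Comparing coefficients in this way yields all algebraic properties
  of \<open>g\<close>.\<close>

lemma transversal_unique:
  assumes q: "q \<in> topspace N" and "z \<in> T q" "z' \<in> T q" and eq: "z + s *\<^sub>R \<phi> q = z' + s' *\<^sub>R \<phi> q"
  shows "s = s' \<and> z = z'"
proof -
  have "s = s'"
  proof (rule ccontr)
    assume ne: "s \<noteq> s'"
    have "z - z' \<in> T q"
      using assms subspace_T subspace_diff by blast
    moreover have "z - z' = (s' - s) *\<^sub>R \<phi> q"
      using eq by (simp add: algebra_simps)
    ultimately have "(- \<epsilon> / (s' - s)) *\<^sub>R ((s' - s) *\<^sub>R \<phi> q) \<in> T q"
      using subspace_T[OF q] subspace_scale by metis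
    with ne trans[OF q] show False
      by simp
  qed
  with eq show ?thesis by simp
qed

text \<open>Constant coefficient fields already realise every pair of tangent vectors at a point, so
  this instance of the Gauss formula determines \<open>g\<close> there.\<close>

lemma gauss_const:
  assumes x: "(U, x) \<in> \<A>" "u \<in> U"
  shows "\<exists>z\<in>T (x u). frechet_derivative (\<lambda>v. D x v b) (at u) a =
    z + (- \<epsilon> * g (x u) (D x u a) (D x u b)) *\<^sub>R \<phi> (x u)"
proof -
  have "\<forall>X Y. smooth_on U X \<longrightarrow> smooth_on U Y \<longrightarrow>
      (\<forall>u\<in>U. \<exists>z\<in>T (x u). frechet_derivative (\<lambda>v. D x v (Y v)) (at u) (X u) =
        z + g (x u) (D x u (X u)) (D x u (Y u)) *\<^sub>R - \<epsilon> *\<^sub>R \<phi> (x u))"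
    using gauss x(1) unfolding gauss_formula_def Let_def by blast
  from this[rule_format, OF smooth_on_const[of U a] smooth_on_const[of U b] x(2)]
  show ?thesis
    by (simp add: mult.commute)
qed

lemma D_expand:
  assumes "(U, x) \<in> \<A>" "u \<in> U"
  shows "D x u b = (b $ 1) *\<^sub>R D x u (axis 1 1) + (b $ 2) *\<^sub>R D x u (axis 2 1)"
proof -
  interpret linear "D x u"
    using assms by (rule linear_D)
  have "b = (b $ 1) *\<^sub>R axis 1 1 + (b $ 2) *\<^sub>R axis 2 1"
    by (simp add: vec_eq_iff forall_2 axis_def)
  then show ?thesis
    by (metis add scaleR)
qed

lemma has_derivative_frame:
  assumes x: "(U, x) \<in> \<A>" "u \<in> U"
  shows "((\<lambda>v. D x v b) has_derivative frechet_derivative (\<lambda>v. D x v b) (at u)) (at u)"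
  using smooth_on_has_derivative[OF smooth_on_frechet_derivative[OF smooth_chart[OF x(1)]] x(2)] .

lemma second_derivative_expand:
  assumes x: "(U, x) \<in> \<A>" "u \<in> U"
  shows "frechet_derivative (\<lambda>v. D x v b) (at u) a =
    (b $ 1) *\<^sub>R frechet_derivative (\<lambda>v. D x v (axis 1 1)) (at u) a +
    (b $ 2) *\<^sub>R frechet_derivative (\<lambda>v. D x v (axis 2 1)) (at u) a"
proof -
  have "((\<lambda>v. (b $ 1) *\<^sub>R D x v (axis 1 1) + (b $ 2) *\<^sub>R D x v (axis 2 1)) has_derivative
      (\<lambda>a. (b $ 1) *\<^sub>R frechet_derivative (\<lambda>v. D x v (axis 1 1)) (at u) a +
        (b $ 2) *\<^sub>R frechet_derivative (\<lambda>v. D x v (axis 2 1)) (at u) a)) (at u)"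
    by (intro has_derivative_add has_derivative_scaleR_right has_derivative_frame[OF x])
  then have "((\<lambda>v. D x v b) has_derivative
      (\<lambda>a. (b $ 1) *\<^sub>R frechet_derivative (\<lambda>v. D x v (axis 1 1)) (at u) a +
        (b $ 2) *\<^sub>R frechet_derivative (\<lambda>v. D x v (axis 2 1)) (at u) a)) (at u)"
    \<comment> \<open>The expansion of \<open>D x v b\<close> is available only for v in the chart
      domain, so the two functions agree merely near \<open>u\<close>.\<close>
    by (rule has_derivative_transform_within_open[OF _ open_chart[OF x(1)] x(2)])
      (rule D_expand[OF x(1), symmetric])
  from fun_cong[OF frechet_derivative_at[OF this], of a] show ?thesis
    by (rule sym)
qed

lemma metric_of_second_derivative:
  assumes x: "(U, x) \<in> \<A>" "u \<in> U"
    and "frechet_derivative (\<lambda>v. D x v b) (at u) a = z + s *\<^sub>R \<phi> (x u)" "z \<in> T (x u)"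
  shows "s = - \<epsilon> * g (x u) (D x u a) (D x u b)"
  using gauss_const[OF x, of b a] transversal_unique[OF chart_in_topspace[OF x]] assms(3,4)
  by metis

text \<open>The second argument is the field being differentiated. The second derivative is linear
  in its coefficients, and reading off the component along \<phi> transfers this to
  \<open>g\<close>.\<close>

lemma metric_right_expand:
  assumes x: "(U, x) \<in> \<A>" "u \<in> U"
  shows "g (x u) (D x u a) (D x u b) =
    b $ 1 * g (x u) (D x u a) (D x u (axis 1 1)) + b $ 2 * g (x u) (D x u a) (D x u (axis 2 1))"
proof -
  have sub: "subspace (T (x u))"
    using subspace_T chart_in_topspace[OF x] .
  obtain z1 where z1: "z1 \<in> T (x u)" "frechet_derivative (\<lambda>v. D x v (axis 1 1)) (at u) a =
      z1 + (- \<epsilon> * g (x u) (D x u a) (D x u (axis 1 1))) *\<^sub>R \<phi> (x u)"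
    using gauss_const[OF x] by blast
  obtain z2 where z2: "z2 \<in> T (x u)" "frechet_derivative (\<lambda>v. D x v (axis 2 1)) (at u) a =
      z2 + (- \<epsilon> * g (x u) (D x u a) (D x u (axis 2 1))) *\<^sub>R \<phi> (x u)"
    using gauss_const[OF x] by blast
  have "frechet_derivative (\<lambda>v. D x v b) (at u) a = ((b $ 1) *\<^sub>R z1 + (b $ 2) *\<^sub>R z2) +
      (b $ 1 * (- \<epsilon> * g (x u) (D x u a) (D x u (axis 1 1))) +
       b $ 2 * (- \<epsilon> * g (x u) (D x u a) (D x u (axis 2 1)))) *\<^sub>R \<phi> (x u)"
    unfolding second_derivative_expand[OF x, of b] z1(2) z2(2) by (simp add: algebra_simps)
  from metric_of_second_derivative[OF x this]
  have "b $ 1 * (- \<epsilon> * g (x u) (D x u a) (D x u (axis 1 1))) +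
      b $ 2 * (- \<epsilon> * g (x u) (D x u a) (D x u (axis 2 1))) =
      - \<epsilon> * g (x u) (D x u a) (D x u b)"
    using z1(1) z2(1) sub by (simp add: subspace_add subspace_scale)
  then show ?thesis
    using eps by auto
qed

text \<open>The first argument is the direction of differentiation, in which every derivative is
  linear; again the component along \<phi> is compared.\<close>

lemma metric_left_expand:
  assumes x: "(U, x) \<in> \<A>" "u \<in> U"
  shows "g (x u) (D x u a) (D x u b) =
    a $ 1 * g (x u) (D x u (axis 1 1)) (D x u b) + a $ 2 * g (x u) (D x u (axis 2 1)) (D x u b)"
proof -
  have sub: "subspace (T (x u))"
    using subspace_T chart_in_topspace[OF x] .
  interpret B: linear "frechet_derivative (\<lambda>v. D x v b) (at u)"
    using has_derivative_frame[OF x] has_derivative_linear by blast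
  obtain z1 where z1: "z1 \<in> T (x u)" "frechet_derivative (\<lambda>v. D x v b) (at u) (axis 1 1) =
      z1 + (- \<epsilon> * g (x u) (D x u (axis 1 1)) (D x u b)) *\<^sub>R \<phi> (x u)"
    using gauss_const[OF x] by blast
  obtain z2 where z2: "z2 \<in> T (x u)" "frechet_derivative (\<lambda>v. D x v b) (at u) (axis 2 1) =
      z2 + (- \<epsilon> * g (x u) (D x u (axis 2 1)) (D x u b)) *\<^sub>R \<phi> (x u)"
    using gauss_const[OF x] by blast
  have "a = (a $ 1) *\<^sub>R axis 1 1 + (a $ 2) *\<^sub>R axis 2 1"
    by (simp add: vec_eq_iff forall_2 axis_def)
  then have "frechet_derivative (\<lambda>v. D x v b) (at u) a =
      (a $ 1) *\<^sub>R frechet_derivative (\<lambda>v. D x v b) (at u) (axis 1 1) +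
      (a $ 2) *\<^sub>R frechet_derivative (\<lambda>v. D x v b) (at u) (axis 2 1)"
    by (metis B.add B.scaleR)
  also have "\<dots> = ((a $ 1) *\<^sub>R z1 + (a $ 2) *\<^sub>R z2) +
      (a $ 1 * (- \<epsilon> * g (x u) (D x u (axis 1 1)) (D x u b)) +
       a $ 2 * (- \<epsilon> * g (x u) (D x u (axis 2 1)) (D x u b))) *\<^sub>R \<phi> (x u)"
    unfolding z1(2) z2(2) by (simp add: algebra_simps)
  finally have eq: "frechet_derivative (\<lambda>v. D x v b) (at u) a = \<dots>" .
  have "a $ 1 * (- \<epsilon> * g (x u) (D x u (axis 1 1)) (D x u b)) +
      a $ 2 * (- \<epsilon> * g (x u) (D x u (axis 2 1)) (D x u b)) =
      - \<epsilon> * g (x u) (D x u a) (D x u b)"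
    by (rule metric_of_second_derivative[OF x eq])
      (use z1(1) z2(1) sub in \<open>simp add: subspace_add subspace_scale\<close>)
  then show ?thesis
    using eps by auto
qed

lemma metric_expand:
  assumes "(U, x) \<in> \<A>" "u \<in> U"
  shows "g (x u) (D x u a) (D x u b) =
    (\<Sum>k\<in>UNIV. \<Sum>l\<in>UNIV. a $ k * b $ l * g (x u) (D x u (axis k 1)) (D x u (axis l 1)))"
  unfolding metric_left_expand[OF assms, of a] metric_right_expand[OF assms, of _ b] sum_2
  by (simp add: algebra_simps)

text \<open>Positive definiteness speaks of nonzero vectors only, so this value too has to come from
  bilinearity. It gives the length of the t-direction under h.\<close>

lemma metric_zero:
  assumes "q \<in> topspace N"
  shows "g q 0 0 = 0"
proof -
  obtain U x u where x: "(U, x) \<in> \<A>" "u \<in> U" and "x u = q"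
    using assms by (rule chart_exists)
  moreover have "D x u 0 = 0"
    using linear_D[OF x] linear_0 by blast
  ultimately show ?thesis
    using metric_expand[OF x, of 0 0] by simp
qed

lemma metric_pos: "q \<in> topspace N \<Longrightarrow> v \<in> T q \<Longrightarrow> v \<noteq> 0 \<Longrightarrow> g q v v > 0"
  using posdef unfolding positive_definite_metric_def by blast

lemma tangent_vector_exists:
  assumes q: "q \<in> topspace N"
  shows "\<exists>v\<in>T q. v \<noteq> 0"
proof -
  obtain U x u where x: "(U, x) \<in> \<A>" "u \<in> U" "x u = q"
    using q by (rule chart_exists)
  have "D x u (axis 1 1) \<noteq> 0"
    using inj_D[OF x(1,2)] linear_D[OF x(1,2)] linear_injective_0
    by (metis axis_eq_0_iff zero_neq_one)
  then show ?thesis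
    using T_eq[OF x(1,2)] x(3) by auto
qed

text \<open>The volume condition of \<phi> on its coordinate frame. Replacing the affine normal by
  \<phi> costs a factor of absolute value 1, and squaring removes the root.\<close>

lemma volume_squared:
  assumes x: "(U, x) \<in> \<A>" "u \<in> U"
  defines "e \<equiv> \<lambda>k. D x u (axis k 1)"
  shows "(det (vector [e 1, e 2, \<phi> (x u)] :: real^3^3))\<^sup>2 =
    \<bar>g (x u) (e 1) (e 1) * g (x u) (e 2) (e 2) - g (x u) (e 1) (e 2) * g (x u) (e 2) (e 1)\<bar>"
proof -
  define i :: "3 \<Rightarrow> 2 option" where "i k = (if k = 1 then Some 1 else if k = 2 then Some 2 else None)" for k
  have "surj i"
  proof (rule surjI)
    show "i (case k of Some j \<Rightarrow> (if j = 1 then 1 else 2) | None \<Rightarrow> 3) = k" for k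
      using exhaust_2[of "the k"] by (auto simp: i_def split: option.split)
  qed
  moreover have "inj i"
    unfolding inj_def forall_3 by (simp add: i_def)
  ultimately have "bij i"
    by (simp add: bij_def)
  moreover have "\<forall>k. e k \<in> T (x u)"
    unfolding e_def T_eq[OF x] by auto
  ultimately have "\<bar>det (\<chi> k. case i k of Some k \<Rightarrow> e k | None \<Rightarrow> - \<epsilon> *\<^sub>R \<phi> (x u))\<bar> =
      sqrt \<bar>det ((\<chi> k l. g (x u) (e k) (e l)) :: real^2^2)\<bar>"
    using vol chart_in_topspace[OF x] unfolding equal_volume_forms_def by blast
  moreover have "det (\<chi> k. case i k of Some k \<Rightarrow> e k | None \<Rightarrow> - \<epsilon> *\<^sub>R \<phi> (x u)) =
      - \<epsilon> * det (vector [e 1, e 2, \<phi> (x u)])"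
    unfolding det_3 by (simp add: i_def algebra_simps)
  moreover have "\<bar>- \<epsilon> * det (vector [e 1, e 2, \<phi> (x u)] :: real^3^3)\<bar> =
      \<bar>det (vector [e 1, e 2, \<phi> (x u)] :: real^3^3)\<bar>"
    using eps by auto
  ultimately have "\<bar>det (vector [e 1, e 2, \<phi> (x u)] :: real^3^3)\<bar> =
      sqrt \<bar>det ((\<chi> k l. g (x u) (e k) (e l)) :: real^2^2)\<bar>"
    by simp
  then have "(det (vector [e 1, e 2, \<phi> (x u)] :: real^3^3))\<^sup>2 =
      \<bar>det ((\<chi> k l. g (x u) (e k) (e l)) :: real^2^2)\<bar>"
    by (metis abs_ge_zero power2_abs real_sqrt_pow2)
  then show ?thesis
    by (simp add: det_2)
qed

end

section \<open>Warped products\<close>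

locale warped_surface = centroaffine_surface N \<A> \<phi> \<epsilon> H0 g
  for N :: "'p topology" and \<A> :: "(2, 'p) atlas" and \<phi> :: "'p \<Rightarrow> real^3"
    and \<epsilon> H0 :: real and g :: "'p \<Rightarrow> real^3 \<Rightarrow> real^3 \<Rightarrow> real" +
  fixes I :: "real set" and \<gamma>1 \<gamma>2 :: "real \<Rightarrow> real" and c H :: real
  assumes open_I: "open I"
    and smooth_\<gamma>: "smooth_on I \<gamma>1" "smooth_on I \<gamma>2"
begin

definition K :: "real \<Rightarrow> real"
  where "K t = deriv \<gamma>1 t * deriv (deriv \<gamma>2) t - deriv (deriv \<gamma>1) t * deriv \<gamma>2 t"

definition W :: "real \<Rightarrow> real"
  where "W t = (c - H * \<gamma>1 t) * deriv \<gamma>2 t + H * \<gamma>2 t * deriv \<gamma>1 t"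

definition \<Phi> :: "real \<times> 'p \<Rightarrow> real^4"
  where "\<Phi> = warped_immersion \<gamma>1 \<gamma>2 \<phi>"

definition \<xi> :: "real \<times> 'p \<Rightarrow> real^4"
  where "\<xi> z = cons_vec4 c 0 - H *\<^sub>R \<Phi> z"

text \<open>The tangent vector of \<open>\<Phi>\<close> at \<open>(t, q)\<close> in direction \<open>r \<partial>\<^sub>t + v\<close>; \<open>h\<close> below recovers \<open>r\<close> and \<open>v\<close>
  from it by dividing by \<open>\<gamma>\<^sub>1'\<close> and \<open>\<gamma>\<^sub>2\<close>, which do not vanish.\<close>

definition emb :: "real \<Rightarrow> 'p \<Rightarrow> real \<Rightarrow> real^3 \<Rightarrow> real^4"
  where "emb t q r v =
    cons_vec4 (deriv \<gamma>1 t * r) ((deriv \<gamma>2 t * r) *\<^sub>R \<phi> q + \<gamma>2 t *\<^sub>R v)"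

text \<open>Cramer's rule: the coefficient of \<xi> when the second t-derivative of \<Phi>, with
  coordinates (\<open>\<gamma>1\<close>'', \<open>\<gamma>2\<close>''), is written in terms of \<xi>
  and the first t-derivative.\<close>

definition \<alpha> :: "real \<Rightarrow> real"
  where "\<alpha> t = - K t / W t"

text \<open>The Gauss formula of \<phi> contributes g times the vector with coordinates (0,
  -\<epsilon> \<open>\<gamma>2\<close>). Cramer's rule gives this as its coefficient of \<xi>
  relative to the same pair.\<close>

definition \<beta> :: "real \<Rightarrow> real"
  where "\<beta> t = \<epsilon> * \<gamma>2 t * deriv \<gamma>1 t / W t"

definition h :: "real \<times> 'p \<Rightarrow> real^4 \<Rightarrow> real^4 \<Rightarrow> real"
  where "h = (\<lambda>(t, q) X Y.
    let r = (\<lambda>X. X $ 1 / deriv \<gamma>1 t);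
        v = (\<lambda>X. (tl_vec4 X - (deriv \<gamma>2 t * r X) *\<^sub>R \<phi> q) /\<^sub>R \<gamma>2 t)
    in \<alpha> t * (r X * r Y) + \<beta> t * g q (v X) (v Y))"

abbreviation "NI \<equiv> prod_topology (top_of_set I) N"
abbreviation "\<A>I \<equiv> interval_times_atlas I \<A>"

lemma \<Phi>_eq: "\<Phi> (t, q) = cons_vec4 (\<gamma>1 t) (\<gamma>2 t *\<^sub>R \<phi> q)"
  by (simp add: \<Phi>_def warped_immersion_eq)

lemma \<xi>_eq: "\<xi> (t, q) = cons_vec4 (c - H * \<gamma>1 t) ((- H * \<gamma>2 t) *\<^sub>R \<phi> q)"
  by (simp add: \<xi>_def \<Phi>_eq vec_eq_iff forall_4)

lemma \<Phi>_chart: "\<Phi> \<circ> interval_times_chart x =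
    (\<lambda>u. cons_vec4 (\<gamma>1 (u $ 1)) (\<gamma>2 (u $ 1) *\<^sub>R (\<phi> \<circ> x) (tl_vec u)))"
  by (auto simp: interval_times_chart_def \<Phi>_eq)

lemma open_chart_I: "(U, x) \<in> \<A> \<Longrightarrow> open (interval_times I U)"
  using open_I open_chart open_interval_times by blast

lemma smooth_map_\<Phi>: "smooth_map \<A>I \<Phi>"
  unfolding smooth_map_def interval_times_atlas_eq
proof clarsimp
  fix U x assume x: "(U, x) \<in> \<A>"
  note op = open_chart_I[OF x]
  have fst: "bounded_linear (\<lambda>u::real^3. u $ 1)"
    by (rule bounded_linear_vec_nth)
  have sub: "interval_times I U \<subseteq> (\<lambda>u. u $ 1) -` I" "interval_times I U \<subseteq> tl_vec -` U"
    by auto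
  show "smooth_on (interval_times I U) (\<Phi> \<circ> interval_times_chart x)"
    unfolding \<Phi>_chart
    by (intro smooth_on_cons_vec4 smooth_on_scaleR op
        smooth_on_comp_linear[OF fst open_I smooth_\<gamma>(1) sub(1)]
        smooth_on_comp_linear[OF fst open_I smooth_\<gamma>(2) sub(1)]
        smooth_on_comp_linear[OF bounded_linear_tl_vec open_chart[OF x] smooth_chart[OF x] sub(2)])
qed

lemma has_derivative_\<gamma>:
  assumes "t \<in> I"
  shows "(\<gamma>1 has_real_derivative deriv \<gamma>1 t) (at t)" "(\<gamma>2 has_real_derivative deriv \<gamma>2 t) (at t)"
    "(deriv \<gamma>1 has_real_derivative deriv (deriv \<gamma>1) t) (at t)"
    "(deriv \<gamma>2 has_real_derivative deriv (deriv \<gamma>2) t) (at t)"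
  using assms smooth_\<gamma> smooth_on_deriv[OF open_I] by (auto intro!: smooth_on_imp_DERIV)

lemma has_derivative_comp_fst:
  assumes "(f has_real_derivative f') (at (u $ 1))"
  shows "((\<lambda>u::real^3. f (u $ 1)) has_derivative (\<lambda>a. f' * a $ 1)) (at u)"
  using has_derivative_compose[OF bounded_linear_imp_has_derivative[OF bounded_linear_vec_nth]
      assms[unfolded has_field_derivative_def]] .

lemma has_derivative_comp_tl_vec:
  assumes "(f has_derivative f') (at (tl_vec u))"
  shows "((\<lambda>u. f (tl_vec u)) has_derivative (\<lambda>a. f' (tl_vec a))) (at u)"
  using has_derivative_compose[OF bounded_linear_imp_has_derivative[OF bounded_linear_tl_vec] assms] .

lemma has_derivative_\<Phi>:
  assumes x: "(U, x) \<in> \<A>" and u: "u \<in> interval_times I U"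
  shows "(\<Phi> \<circ> interval_times_chart x has_derivative
    (\<lambda>a. emb (u $ 1) (x (tl_vec u)) (a $ 1) (D x (tl_vec u) (tl_vec a)))) (at u)"
proof -
  have t: "u $ 1 \<in> I" and v: "tl_vec u \<in> U"
    using u by auto
  have "(\<Phi> \<circ> interval_times_chart x has_derivative
      (\<lambda>a. cons_vec4 (deriv \<gamma>1 (u $ 1) * a $ 1)
        (\<gamma>2 (u $ 1) *\<^sub>R D x (tl_vec u) (tl_vec a) +
          (deriv \<gamma>2 (u $ 1) * a $ 1) *\<^sub>R (\<phi> \<circ> x) (tl_vec u)))) (at u)"
    unfolding \<Phi>_chart
    by (intro has_derivative_cons_vec4 has_derivative_scaleR has_derivative_comp_fst
        has_derivative_comp_tl_vec has_derivative_\<gamma> has_derivative_D[OF x v] t)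
  then show ?thesis
    by (simp add: emb_def add.commute)
qed

lemma frechet_derivative_\<Phi>:
  assumes "(U, x) \<in> \<A>" and "u \<in> interval_times I U"
  shows "frechet_derivative (\<Phi> \<circ> interval_times_chart x) (at u) a =
    emb (u $ 1) (x (tl_vec u)) (a $ 1) (D x (tl_vec u) (tl_vec a))"
  using fun_cong[OF frechet_derivative_at[OF has_derivative_\<Phi>[OF assms]], of a] by (rule sym)

text \<open>Describes tangent vectors by a number and a vector tangent to \<phi>, so that
  transversality, nondegeneracy and indefiniteness can be checked without product charts.\<close>

lemma tangent_space_\<Phi>:
  assumes t: "t \<in> I" and q: "q \<in> topspace N"
  shows "tangent_space \<A>I \<Phi> (t, q) = {emb t q r v | r v. v \<in> T q}"
proof (intro Set.equalityI subsetI)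
  fix X assume "X \<in> tangent_space \<A>I \<Phi> (t, q)"
  then obtain U x u a where x: "(U, x) \<in> \<A>" and u: "u \<in> interval_times I U"
    and eq: "u $ 1 = t" "x (tl_vec u) = q"
    and X: "X = frechet_derivative (\<Phi> \<circ> interval_times_chart x) (at u) a"
    unfolding tangent_space_def interval_times_atlas_eq by auto
  have "D x (tl_vec u) (tl_vec a) \<in> T q"
    using T_eq[OF x, of "tl_vec u"] u eq by auto
  then show "X \<in> {emb t q r v | r v. v \<in> T q}"
    unfolding X frechet_derivative_\<Phi>[OF x u] eq by blast
next
  fix X assume "X \<in> {emb t q r v | r v. v \<in> T q}"
  then obtain r v where X: "X = emb t q r v" and v: "v \<in> T q"
    by blast
  obtain U x u where x: "(U, x) \<in> \<A>" "u \<in> U" "x u = q"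
    using q by (rule chart_exists)
  obtain b where b: "v = D x u b"
    using v T_eq[OF x(1,2)] x(3) by auto
  have u': "cons_vec t u \<in> interval_times I U"
    using t x by simp
  have "X = frechet_derivative (\<Phi> \<circ> interval_times_chart x) (at (cons_vec t u)) (cons_vec r b)"
    unfolding X frechet_derivative_\<Phi>[OF x(1) u'] using x b by simp
  moreover have "interval_times_chart x (cons_vec t u) = (t, q)"
    using x by simp
  moreover have "(interval_times I U, interval_times_chart x) \<in> \<A>I"
    using x by (force simp: interval_times_atlas_eq)
  ultimately show "X \<in> tangent_space \<A>I \<Phi> (t, q)"
    unfolding tangent_space_def using u' by blast
qed

end

text \<open>Both differential equations of the theorem are instances of this one; only the value of
  \<open>W\<close> depends on \<open>c\<close> and \<open>H\<close>.\<close>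

locale warped_affine_sphere = warped_surface +
  assumes curve: "t \<in> I \<Longrightarrow> (\<gamma>2 t)\<^sup>2 * \<bar>W t\<bar> ^ 5 =
      sgn (deriv \<gamma>1 t * \<gamma>2 t * \<epsilon>) * K t * (deriv \<gamma>1 t)\<^sup>2"
    and curve_ne: "t \<in> I \<Longrightarrow> (\<gamma>2 t)\<^sup>2 * \<bar>W t\<bar> ^ 5 \<noteq> 0"
begin

text \<open>The two sides of the curve equation agree and do not vanish, so no factor of either side
  does. \<open>\<gamma>2\<close> and the derivative of \<open>\<gamma>1\<close> make
  \<open>emb\<close> injective, \<open>W\<close> makes \<xi> transversal, and \<open>K\<close> makes
  \<alpha> nonzero.\<close>

lemma nonzero:
  assumes "t \<in> I"
  shows "\<gamma>2 t \<noteq> 0" "W t \<noteq> 0" "deriv \<gamma>1 t \<noteq> 0" "K t \<noteq> 0"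
  using curve[OF assms] curve_ne[OF assms] by auto

text \<open>The left side of the curve equation is positive, so \<open>K\<close> has the sign of
  \<open>deriv \<gamma>1 t * \<gamma>2 t * \<epsilon>\<close>; and \<alpha> \<beta> is minus the
  product of these two over the square of \<open>W\<close>.\<close>

lemma \<alpha>_\<beta>_neg:
  assumes "t \<in> I"
  shows "\<alpha> t * \<beta> t < 0"
proof -
  note nz = nonzero[OF assms]
  have "0 < (\<gamma>2 t)\<^sup>2 * \<bar>W t\<bar> ^ 5"
    using nz by simp
  then have "0 < sgn (deriv \<gamma>1 t * \<gamma>2 t * \<epsilon>) * K t * (deriv \<gamma>1 t)\<^sup>2"
    using curve[OF assms] by simp
  then have "0 < sgn s * K t" if "s = deriv \<gamma>1 t * \<gamma>2 t * \<epsilon>" for s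
    using nz that by (simp add: zero_less_mult_iff)
  then have "0 < s * K t" if "s = deriv \<gamma>1 t * \<gamma>2 t * \<epsilon>" for s
    using that by (cases s "0::real" rule: linorder_cases) (fastforce simp: mult_neg_neg)+
  then have "0 < deriv \<gamma>1 t * \<gamma>2 t * \<epsilon> * K t"
    by blast
  moreover have "\<alpha> t * \<beta> t = - (deriv \<gamma>1 t * \<gamma>2 t * \<epsilon> * K t) / (W t)\<^sup>2"
    by (simp add: \<alpha>_def \<beta>_def power2_eq_square)
  ultimately show ?thesis
    using nz by (simp add: divide_neg_pos)
qed

text \<open>The origin of the fifth power: \<alpha> and the square of \<beta> put the cube of W in
  the denominator, while the squared volume of the frame has the square of W as a factor.\<close>

lemma \<alpha>_\<beta>_volume:
  assumes "t \<in> I"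
  shows "\<bar>\<alpha> t * (\<beta> t)\<^sup>2\<bar> = (W t * (\<gamma>2 t)\<^sup>2)\<^sup>2"
proof -
  note nz = nonzero[OF assms]
  have "\<bar>(\<gamma>2 t)\<^sup>2 * \<bar>W t\<bar> ^ 5\<bar> = \<bar>sgn (deriv \<gamma>1 t * \<gamma>2 t * \<epsilon>)\<bar> * \<bar>K t\<bar> * (deriv \<gamma>1 t)\<^sup>2"
    unfolding curve[OF assms] by (simp add: abs_mult)
  moreover have "\<bar>sgn (deriv \<gamma>1 t * \<gamma>2 t * \<epsilon>)\<bar> = 1"
    using nz eps by (auto simp: abs_sgn_eq)
  ultimately have K: "\<bar>K t\<bar> * (deriv \<gamma>1 t)\<^sup>2 = (\<gamma>2 t)\<^sup>2 * \<bar>W t\<bar> ^ 5"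
    by (simp add: abs_mult)
  have "\<epsilon>\<^sup>2 = 1"
    using eps by auto
  then have "(\<beta> t)\<^sup>2 = (\<gamma>2 t)\<^sup>2 * (deriv \<gamma>1 t)\<^sup>2 / \<bar>W t\<bar>\<^sup>2"
    by (simp add: \<beta>_def power_divide power_mult_distrib)
  then have "\<bar>\<alpha> t * (\<beta> t)\<^sup>2\<bar> = (\<gamma>2 t)\<^sup>2 * (\<bar>K t\<bar> * (deriv \<gamma>1 t)\<^sup>2) / \<bar>W t\<bar> ^ 3"
    by (simp add: \<alpha>_def abs_mult power3_eq_cube power2_eq_square ac_simps)
  also have "\<dots> = (\<gamma>2 t)\<^sup>2 * (\<gamma>2 t)\<^sup>2 * \<bar>W t\<bar>\<^sup>2"
    unfolding K using nz by (simp add: field_simps eval_nat_numeral)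
  also have "\<dots> = (W t * (\<gamma>2 t)\<^sup>2)\<^sup>2"
    by (simp add: power_mult_distrib power2_eq_square)
  finally show ?thesis .
qed

lemma h_emb:
  assumes "t \<in> I"
  shows "h (t, q) (emb t q r v) (emb t q s w) = \<alpha> t * (r * s) + \<beta> t * g q v w"
  using nonzero[OF assms] by (simp add: h_def emb_def)

lemma emb_eq_0_iff:
  assumes "t \<in> I"
  shows "emb t q r v = 0 \<longleftrightarrow> r = 0 \<and> v = 0"
  using nonzero[OF assms] cons_vec4_inject[of _ _ 0 0] by (auto simp: emb_def cons_vec4_zero)

lemma immersed: "immersed_hypersurface NI \<A>I \<Phi>"
  unfolding immersed_hypersurface_def
proof (intro conjI)
  show "smooth_manifold NI \<A>I"
    using open_I manifold by (rule smooth_manifold_interval_times)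
  show "\<forall>(U, x)\<in>\<A>I. \<forall>u\<in>U. inj (frechet_derivative (\<Phi> \<circ> x) (at u))"
    unfolding interval_times_atlas_eq
  proof clarsimp
    fix U x u assume x: "(U, x) \<in> \<A>" and u: "u $ 1 \<in> I" "tl_vec u \<in> U"
    then have u': "u \<in> interval_times I U"
      by simp
    have lin: "linear (frechet_derivative (\<Phi> \<circ> interval_times_chart x) (at u))"
      by (rule linear_frechet_derivative[OF differentiableI[OF has_derivative_\<Phi>[OF x u']]])
    show "inj (frechet_derivative (\<Phi> \<circ> interval_times_chart x) (at u))"
    proof (subst linear_injective_0[OF lin], intro allI impI)
      fix a assume "frechet_derivative (\<Phi> \<circ> interval_times_chart x) (at u) a = 0"
      then have "a $ 1 = 0" "D x (tl_vec u) (tl_vec a) = 0"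
        using u by (simp_all add: frechet_derivative_\<Phi>[OF x u'] emb_eq_0_iff)
      moreover from this(2) have "tl_vec a = 0"
        using inj_D[OF x u(2)] linear_D[OF x u(2)] linear_injective_0 by blast
      ultimately show "a = 0"
        by (simp add: eq_vec_3_iff vec_eq_iff forall_2)
    qed
  qed
qed (simp_all add: smooth_map_\<Phi>)

lemma transversal: "transversal_field NI \<A>I \<Phi> \<xi>"
  unfolding transversal_field_def
proof (intro conjI ballI)
  show "smooth_map \<A>I \<xi>"
    unfolding smooth_map_def
  proof clarify
    fix U x assume x: "(U, x) \<in> \<A>I"
    have "smooth_on U (\<Phi> \<circ> x)" "open U"
      using x smooth_map_\<Phi> open_chart_I by (auto simp: smooth_map_def interval_times_atlas_eq)
    then have "smooth_on U (\<lambda>u. cons_vec4 c 0 + (- H) *\<^sub>R (\<Phi> \<circ> x) u)"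
      by (intro smooth_on_add smooth_on_scaleR smooth_on_const)
    then show "smooth_on U (\<xi> \<circ> x)"
      by (simp add: \<xi>_def o_def)
  qed
next
  fix z assume "z \<in> topspace NI"
  then obtain t q where z: "z = (t, q)" and t: "t \<in> I" and q: "q \<in> topspace N"
    by auto
  show "\<xi> z \<notin> tangent_space \<A>I \<Phi> z"
  proof
    assume "\<xi> z \<in> tangent_space \<A>I \<Phi> z"
    then obtain r v where v: "v \<in> T q" and "\<xi> (t, q) = emb t q r v"
      unfolding z tangent_space_\<Phi>[OF t q] by blast
    then have 1: "c - H * \<gamma>1 t = deriv \<gamma>1 t * r"
      and 2: "(- H * \<gamma>2 t) *\<^sub>R \<phi> q = (deriv \<gamma>2 t * r) *\<^sub>R \<phi> q + \<gamma>2 t *\<^sub>R v"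
      by (simp_all add: \<xi>_eq emb_def)
    \<comment> \<open>Comparing components along \<phi> shows that the coordinates of \<xi> are
      \<open>r\<close> times the velocity of the curve, so their determinant \<open>W\<close> would
      vanish.\<close>
    have "0 + (- H * \<gamma>2 t) *\<^sub>R \<phi> q = \<gamma>2 t *\<^sub>R v + (deriv \<gamma>2 t * r) *\<^sub>R \<phi> q"
      unfolding 2 by simp
    then have "- H * \<gamma>2 t = deriv \<gamma>2 t * r"
      using transversal_unique[OF q] v subspace_T[OF q] subspace_0 subspace_scale by metis
    with 1 have "W t = deriv \<gamma>1 t * r * deriv \<gamma>2 t - deriv \<gamma>2 t * r * deriv \<gamma>1 t"
      unfolding W_def by (metis add_uminus_conv_diff mult_minus_left minus_minus)
    then show False
      using nonzero[OF t] by simp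
  qed
qed

lemma weingarten: "weingarten_formula \<A>I \<Phi> \<xi> (\<lambda>_ v. H *\<^sub>R v)"
  unfolding weingarten_formula_def Let_def interval_times_atlas_eq
proof (clarsimp, intro conjI)
  fix U x u a assume x: "(U, x) \<in> \<A>" and u: "u $ 1 \<in> I" "tl_vec u \<in> U"
  then have u': "u \<in> interval_times I U"
    by simp
  define X where "X = (\<lambda>a. emb (u $ 1) (x (tl_vec u)) (a $ 1) (D x (tl_vec u) (tl_vec a)))"
  have X: "frechet_derivative (\<Phi> \<circ> interval_times_chart x) (at u) = X"
    unfolding X_def using frechet_derivative_\<Phi>[OF x u'] by blast
  have q: "x (tl_vec u) \<in> topspace N"
    using chart_in_topspace[OF x u(2)] .
  have "D x (tl_vec u) (tl_vec a) \<in> T (x (tl_vec u))"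
    using T_eq[OF x u(2)] by simp
  then have "H *\<^sub>R D x (tl_vec u) (tl_vec a) \<in> T (x (tl_vec u))"
    using subspace_T[OF q] subspace_scale by blast
  moreover have "H *\<^sub>R X a = emb (u $ 1) (x (tl_vec u)) (H * a $ 1) (H *\<^sub>R D x (tl_vec u) (tl_vec a))"
    by (simp add: X_def emb_def cons_vec4_scaleR algebra_simps)
  ultimately have "H *\<^sub>R X a \<in> tangent_space \<A>I \<Phi> (u $ 1, x (tl_vec u))"
    unfolding tangent_space_\<Phi>[OF u(1) q] by blast
  then show "H *\<^sub>R frechet_derivative (\<Phi> \<circ> interval_times_chart x) (at u) a \<in>
      tangent_space ((\<lambda>(U, x). (interval_times I U, interval_times_chart x)) ` \<A>) \<Phi>
        (interval_times_chart x u)"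
    unfolding X interval_times_atlas_eq[symmetric] by (simp add: interval_times_chart_def)
  have "(\<Phi> \<circ> interval_times_chart x has_derivative X) (at u)"
    using has_derivative_\<Phi>[OF x u'] unfolding X_def .
  then have "((\<lambda>u. cons_vec4 c 0 - H *\<^sub>R (\<Phi> \<circ> interval_times_chart x) u) has_derivative
      (\<lambda>a. 0 - H *\<^sub>R X a)) (at u)"
    by (intro has_derivative_diff has_derivative_const has_derivative_scaleR_right)
  then have "(\<xi> \<circ> interval_times_chart x has_derivative (\<lambda>a. - (H *\<^sub>R X a))) (at u)"
    by (simp add: \<xi>_def o_def)
  from fun_cong[OF frechet_derivative_at[OF this], of a]
  show "frechet_derivative (\<xi> \<circ> interval_times_chart x) (at u) a =
      - (H *\<^sub>R frechet_derivative (\<Phi> \<circ> interval_times_chart x) (at u) a)"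
    unfolding X by simp
qed

lemma nondegenerate: "nondegenerate_metric NI \<A>I \<Phi> h"
  unfolding nondegenerate_metric_def
proof (intro ballI impI)
  fix z X assume "z \<in> topspace NI" and X: "X \<in> tangent_space \<A>I \<Phi> z"
    and zero: "\<forall>Y\<in>tangent_space \<A>I \<Phi> z. h z X Y = 0"
  then obtain t q where z: "z = (t, q)" and t: "t \<in> I" and q: "q \<in> topspace N"
    by auto
  obtain r v where v: "v \<in> T q" and X: "X = emb t q r v"
    using X unfolding z tangent_space_\<Phi>[OF t q] by blast
  \<comment> \<open>Testing against vectors with the same \<open>v\<close> and varying
    \<open>s\<close>: s = 0 isolates the term with \<open>g\<close>, then s = r isolates \<alpha>
    times the square of \<open>r\<close>.\<close>
  have *: "\<alpha> t * (r * s) + \<beta> t * g q v v = 0" for s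
    using zero v unfolding z X tangent_space_\<Phi>[OF t q] h_emb[OF t, symmetric] by blast
  have "\<alpha> t \<noteq> 0" "\<beta> t \<noteq> 0"
    using \<alpha>_\<beta>_neg[OF t] by auto
  then have "r = 0" "g q v v = 0"
    using *[of r] *[of 0] by auto
  then have "v = 0"
    using metric_pos[OF q v] by fastforce
  with \<open>r = 0\<close> show "X = 0"
    unfolding X emb_eq_0_iff[OF t] by simp
qed

lemma indefinite: "indefinite_metric NI \<A>I \<Phi> h"
  unfolding indefinite_metric_def
proof
  fix z assume "z \<in> topspace NI"
  then obtain t q where z: "z = (t, q)" and t: "t \<in> I" and q: "q \<in> topspace N"
    by auto
  obtain v where v: "v \<in> T q" "v \<noteq> 0"
    using tangent_vector_exists[OF q] by blast
  \<comment> \<open>The curve direction and a surface direction: h takes the values \<alpha> and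
    \<beta> g(v, v) on them, of opposite signs.\<close>
  define X where "X = emb t q 1 0"
  define Y where "Y = emb t q 0 v"
  have mem: "X \<in> tangent_space \<A>I \<Phi> z" "Y \<in> tangent_space \<A>I \<Phi> z"
    unfolding X_def Y_def z tangent_space_\<Phi>[OF t q] using v subspace_0[OF subspace_T[OF q]] by blast+
  have "h z X X = \<alpha> t" "h z Y Y = \<beta> t * g q v v"
    unfolding X_def Y_def z h_emb[OF t] using metric_zero[OF q] by simp_all
  then have "h z X X > 0 \<and> h z Y Y < 0 \<or> h z X X < 0 \<and> h z Y Y > 0"
    using \<alpha>_\<beta>_neg[OF t] metric_pos[OF q v] by (simp add: mult_less_0_iff zero_less_mult_iff)
  with mem show "(\<exists>v\<in>tangent_space \<A>I \<Phi> z. h z v v > 0) \<and> (\<exists>w\<in>tangent_space \<A>I \<Phi> z. h z w w < 0)"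
    by blast
qed

end

section \<open>Gauss formula and volume form of the warped product\<close>

context warped_affine_sphere
begin

lemma has_derivative_\<Phi>_field:
  assumes x: "(U, x) \<in> \<A>" and u: "u \<in> interval_times I U"
    and Y: "smooth_on (interval_times I U) Y"
  defines "t \<equiv> u $ 1" and "v \<equiv> tl_vec u" and "dY \<equiv> frechet_derivative Y (at u)"
    and "B \<equiv> \<lambda>b. frechet_derivative (\<lambda>v. D x v b) (at (tl_vec u))"
  shows "((\<lambda>w. frechet_derivative (\<Phi> \<circ> interval_times_chart x) (at w) (Y w)) has_derivative
    (\<lambda>a. cons_vec4 (deriv (deriv \<gamma>1) t * a $ 1 * Y u $ 1 + deriv \<gamma>1 t * dY a $ 1)
      ((deriv (deriv \<gamma>2) t * a $ 1 * Y u $ 1 + deriv \<gamma>2 t * dY a $ 1) *\<^sub>R \<phi> (x v) +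
       (deriv \<gamma>2 t * Y u $ 1) *\<^sub>R D x v (tl_vec a) +
       (deriv \<gamma>2 t * a $ 1) *\<^sub>R D x v (tl_vec (Y u)) +
       \<gamma>2 t *\<^sub>R (D x v (tl_vec (dY a)) + B (tl_vec (Y u)) (tl_vec a))))) (at u)"
proof -
  have t: "u $ 1 \<in> I" and v: "tl_vec u \<in> U"
    using u by auto
  \<comment> \<open>In \<open>D x (tl_vec w) (tl_vec (Y w))\<close> both the base point and the
    vector move. Expanding over the two fixed axis vectors leaves products of real functions and
    maps \<open>D x v b\<close> with constant \<open>b\<close>, to which the product rule
    applies.\<close>
  define F where "F w = cons_vec4 (deriv \<gamma>1 (w $ 1) * Y w $ 1)
    ((deriv \<gamma>2 (w $ 1) * Y w $ 1) *\<^sub>R (\<phi> \<circ> x) (tl_vec w) +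
     \<gamma>2 (w $ 1) *\<^sub>R ((Y w $ 2) *\<^sub>R D x (tl_vec w) (axis 1 1) +
       (Y w $ 3) *\<^sub>R D x (tl_vec w) (axis 2 1)))" for w
  have eq: "F w = frechet_derivative (\<Phi> \<circ> interval_times_chart x) (at w) (Y w)"
    if "w \<in> interval_times I U" for w
    using that D_expand[OF x, of "tl_vec w" "tl_vec (Y w)"]
    by (simp add: F_def frechet_derivative_\<Phi>[OF x that] emb_def)
  have Yi: "((\<lambda>w. Y w $ i) has_derivative (\<lambda>a. dY a $ i)) (at u)" for i
    using bounded_linear.has_derivative[OF bounded_linear_vec_nth smooth_on_has_derivative[OF Y u]]
    unfolding dY_def .
  have "(F has_derivative (\<lambda>a. cons_vec4
      (deriv \<gamma>1 (u $ 1) * dY a $ 1 + deriv (deriv \<gamma>1) (u $ 1) * a $ 1 * Y u $ 1)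
      (((deriv \<gamma>2 (u $ 1) * Y u $ 1) *\<^sub>R D x (tl_vec u) (tl_vec a) +
        (deriv \<gamma>2 (u $ 1) * dY a $ 1 + deriv (deriv \<gamma>2) (u $ 1) * a $ 1 * Y u $ 1) *\<^sub>R
          (\<phi> \<circ> x) (tl_vec u)) +
       (\<gamma>2 (u $ 1) *\<^sub>R (((Y u $ 2) *\<^sub>R B (axis 1 1) (tl_vec a) +
            dY a $ 2 *\<^sub>R D x (tl_vec u) (axis 1 1)) +
          ((Y u $ 3) *\<^sub>R B (axis 2 1) (tl_vec a) +
            dY a $ 3 *\<^sub>R D x (tl_vec u) (axis 2 1))) +
        (deriv \<gamma>2 (u $ 1) * a $ 1) *\<^sub>R ((Y u $ 2) *\<^sub>R D x (tl_vec u) (axis 1 1) +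
          (Y u $ 3) *\<^sub>R D x (tl_vec u) (axis 2 1)))))) (at u)"
    unfolding F_def[abs_def] B_def
    by (intro has_derivative_cons_vec4 has_derivative_add has_derivative_scaleR has_derivative_mult
        has_derivative_comp_fst[of "deriv \<gamma>1"] has_derivative_comp_fst[of "deriv \<gamma>2"]
        has_derivative_comp_fst[of "\<gamma>2"] Yi
        has_derivative_comp_tl_vec[of "\<phi> \<circ> x"]
        has_derivative_comp_tl_vec[of "\<lambda>v. D x v (axis 1 1)"]
        has_derivative_comp_tl_vec[of "\<lambda>v. D x v (axis 2 1)"]
        has_derivative_\<gamma> has_derivative_D[OF x v] has_derivative_frame[OF x v] t)
  moreover have "D x v (tl_vec b) = (b $ 2) *\<^sub>R D x v (axis 1 1) + (b $ 3) *\<^sub>R D x v (axis 2 1)" for b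
    using D_expand[OF x, of v "tl_vec b"] v by (simp add: v_def)
  moreover have "B (tl_vec b) a = (b $ 2) *\<^sub>R B (axis 1 1) a + (b $ 3) *\<^sub>R B (axis 2 1) a" for a b
    using second_derivative_expand[OF x v, of "tl_vec b" a] by (simp add: B_def)
  ultimately have "(F has_derivative
    (\<lambda>a. cons_vec4 (deriv (deriv \<gamma>1) t * a $ 1 * Y u $ 1 + deriv \<gamma>1 t * dY a $ 1)
      ((deriv (deriv \<gamma>2) t * a $ 1 * Y u $ 1 + deriv \<gamma>2 t * dY a $ 1) *\<^sub>R \<phi> (x v) +
       (deriv \<gamma>2 t * Y u $ 1) *\<^sub>R D x v (tl_vec a) +
       (deriv \<gamma>2 t * a $ 1) *\<^sub>R D x v (tl_vec (Y u)) +
       \<gamma>2 t *\<^sub>R (D x v (tl_vec (dY a)) + B (tl_vec (Y u)) (tl_vec a))))) (at u)"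
    by (simp add: t_def[symmetric] v_def[symmetric] ac_simps scaleR_add_right)
  then show ?thesis
    by (rule has_derivative_transform_within_open[OF _ open_chart_I[OF x] u]) (rule eq)
qed

text \<open>The pointwise algebra of the Gauss formula. The first coordinate forces
  \<open>r\<close>, the vectors tangent to \<phi> pass into \<open>emb\<close> after division by
  \<open>\<gamma>2\<close>, and what remains is one identity for the coefficient of \<phi>.\<close>

lemma gauss_decomposition:
  fixes a1 y1 dy1 G r s :: real and Da Dy Ddy z :: "real^3"
  assumes t: "t \<in> I"
  defines "s \<equiv> \<alpha> t * (a1 * y1) + \<beta> t * G"
  defines "r \<equiv> dy1 + (deriv (deriv \<gamma>1) t * a1 * y1 - (c - H * \<gamma>1 t) * s) / deriv \<gamma>1 t"
  shows "cons_vec4 (deriv (deriv \<gamma>1) t * a1 * y1 + deriv \<gamma>1 t * dy1)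
      ((deriv (deriv \<gamma>2) t * a1 * y1 + deriv \<gamma>2 t * dy1) *\<^sub>R \<phi> q +
       (deriv \<gamma>2 t * y1) *\<^sub>R Da + (deriv \<gamma>2 t * a1) *\<^sub>R Dy +
       \<gamma>2 t *\<^sub>R (Ddy + (z + (- \<epsilon> * G) *\<^sub>R \<phi> q))) =
    emb t q r ((deriv \<gamma>2 t * y1 / \<gamma>2 t) *\<^sub>R Da + (deriv \<gamma>2 t * a1 / \<gamma>2 t) *\<^sub>R Dy + Ddy + z) +
      s *\<^sub>R \<xi> (t, q)"
proof -
  note nz = nonzero[OF t]
  have Ws: "W t * s = - K t * (a1 * y1) + \<epsilon> * \<gamma>2 t * deriv \<gamma>1 t * G"
    using nz by (simp add: s_def \<alpha>_def \<beta>_def field_simps)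
  have r: "deriv \<gamma>1 t * r = deriv \<gamma>1 t * dy1 + deriv (deriv \<gamma>1) t * a1 * y1 - (c - H * \<gamma>1 t) * s"
    using nz by (simp add: r_def field_simps)
  \<comment> \<open>The identity for the coefficient of \<phi> is first multiplied by the derivative
    of \<open>\<gamma>1\<close>: then \<open>r\<close> enters without its denominator and the terms
    in \<open>s\<close> combine to \<open>W t * s\<close>.\<close>
  have "deriv \<gamma>1 t * (deriv \<gamma>2 t * r + s * (- H * \<gamma>2 t)) =
      deriv \<gamma>2 t * (deriv \<gamma>1 t * r) - deriv \<gamma>1 t * H * \<gamma>2 t * s"
    by (simp add: algebra_simps)
  also have "\<dots> = deriv \<gamma>2 t * (deriv \<gamma>1 t * dy1 + deriv (deriv \<gamma>1) t * a1 * y1) - W t * s"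
    unfolding r W_def by (simp add: algebra_simps)
  also have "\<dots> = deriv \<gamma>1 t *
      (deriv (deriv \<gamma>2) t * a1 * y1 + deriv \<gamma>2 t * dy1 - \<epsilon> * \<gamma>2 t * G)"
    unfolding Ws K_def by (simp add: algebra_simps)
  finally have normal: "deriv \<gamma>2 t * r + s * (- H * \<gamma>2 t) =
      deriv (deriv \<gamma>2) t * a1 * y1 + deriv \<gamma>2 t * dy1 - \<epsilon> * \<gamma>2 t * G"
    using nz by simp
  show ?thesis
    unfolding emb_def \<xi>_eq cons_vec4_scaleR cons_vec4_add cons_vec4_inject
  proof
    show "deriv (deriv \<gamma>1) t * a1 * y1 + deriv \<gamma>1 t * dy1 =
        deriv \<gamma>1 t * r + s * (c - H * \<gamma>1 t)"
      unfolding r by (simp add: algebra_simps)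
    have "(deriv \<gamma>2 t * r) *\<^sub>R \<phi> q + \<gamma>2 t *\<^sub>R ((deriv \<gamma>2 t * y1 / \<gamma>2 t) *\<^sub>R Da +
          (deriv \<gamma>2 t * a1 / \<gamma>2 t) *\<^sub>R Dy + Ddy + z) + s *\<^sub>R (- H * \<gamma>2 t) *\<^sub>R \<phi> q =
        (deriv \<gamma>2 t * r + s * (- H * \<gamma>2 t)) *\<^sub>R \<phi> q +
        (deriv \<gamma>2 t * y1) *\<^sub>R Da + (deriv \<gamma>2 t * a1) *\<^sub>R Dy + \<gamma>2 t *\<^sub>R (Ddy + z)"
      using nz by (simp add: scaleR_add_right scaleR_diff_left)
    then show "(deriv (deriv \<gamma>2) t * a1 * y1 + deriv \<gamma>2 t * dy1) *\<^sub>R \<phi> q +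
        (deriv \<gamma>2 t * y1) *\<^sub>R Da + (deriv \<gamma>2 t * a1) *\<^sub>R Dy +
        \<gamma>2 t *\<^sub>R (Ddy + (z + (- \<epsilon> * G) *\<^sub>R \<phi> q)) =
        (deriv \<gamma>2 t * r) *\<^sub>R \<phi> q + \<gamma>2 t *\<^sub>R ((deriv \<gamma>2 t * y1 / \<gamma>2 t) *\<^sub>R Da +
          (deriv \<gamma>2 t * a1 / \<gamma>2 t) *\<^sub>R Dy + Ddy + z) + s *\<^sub>R (- H * \<gamma>2 t) *\<^sub>R \<phi> q"
      unfolding normal by (simp add: algebra_simps)
  qed
qed

lemma gauss_\<Phi>: "gauss_formula \<A>I \<Phi> \<xi> h"
  unfolding gauss_formula_def Let_def
proof clarify
  fix U' x' and X Y :: "real^3 \<Rightarrow> real^3" and u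
  assume "(U', x') \<in> \<A>I" and smooth_Y: "smooth_on U' Y" and u: "u \<in> U'"
  then obtain U x where x: "(U, x) \<in> \<A>"
    and eq: "U' = interval_times I U" "x' = interval_times_chart x"
    by (auto simp: interval_times_atlas_eq)
  note u = u[unfolded eq] and smooth_Y = smooth_Y[unfolded eq]
  define t where "t = u $ 1"
  define v where "v = tl_vec u"
  define q where "q = x v"
  define dY where "dY = frechet_derivative Y (at u) (X u)"
  have t: "t \<in> I" and v: "v \<in> U"
    using u by (auto simp: t_def v_def)
  have q: "q \<in> topspace N"
    unfolding q_def using chart_in_topspace[OF x v] .
  have DT: "D x v b \<in> T q" for b
    unfolding q_def T_eq[OF x v] by simp
  \<comment> \<open>The variation of Y is carried by \<open>dY\<close>, so the Gauss formula of
    \<phi> is applied with the coefficients of Y frozen at \<open>u\<close>.\<close>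
  obtain z where z: "z \<in> T q" and B: "frechet_derivative (\<lambda>v. D x v (tl_vec (Y u))) (at v) (tl_vec (X u)) =
      z + (- \<epsilon> * g q (D x v (tl_vec (X u))) (D x v (tl_vec (Y u)))) *\<^sub>R \<phi> q"
    using gauss_const[OF x v] unfolding q_def by blast
  define s where "s = \<alpha> t * (X u $ 1 * Y u $ 1) + \<beta> t * g q (D x v (tl_vec (X u))) (D x v (tl_vec (Y u)))"
  define Z where "Z = emb t q
    (dY $ 1 + (deriv (deriv \<gamma>1) t * X u $ 1 * Y u $ 1 - (c - H * \<gamma>1 t) * s) / deriv \<gamma>1 t)
    ((deriv \<gamma>2 t * Y u $ 1 / \<gamma>2 t) *\<^sub>R D x v (tl_vec (X u)) +
      (deriv \<gamma>2 t * X u $ 1 / \<gamma>2 t) *\<^sub>R D x v (tl_vec (Y u)) + D x v (tl_vec dY) + z)"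
  have d\<Phi>: "frechet_derivative (\<Phi> \<circ> x') (at u) a = emb t q (a $ 1) (D x v (tl_vec a))" for a
    unfolding eq t_def v_def q_def by (rule frechet_derivative_\<Phi>[OF x u])
  have "frechet_derivative (\<lambda>w. frechet_derivative (\<Phi> \<circ> x') (at w) (Y w)) (at u) (X u) =
    cons_vec4 (deriv (deriv \<gamma>1) t * X u $ 1 * Y u $ 1 + deriv \<gamma>1 t * dY $ 1)
      ((deriv (deriv \<gamma>2) t * X u $ 1 * Y u $ 1 + deriv \<gamma>2 t * dY $ 1) *\<^sub>R \<phi> q +
       (deriv \<gamma>2 t * Y u $ 1) *\<^sub>R D x v (tl_vec (X u)) +
       (deriv \<gamma>2 t * X u $ 1) *\<^sub>R D x v (tl_vec (Y u)) +
       \<gamma>2 t *\<^sub>R (D x v (tl_vec dY) +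
         (z + (- \<epsilon> * g q (D x v (tl_vec (X u))) (D x v (tl_vec (Y u)))) *\<^sub>R \<phi> q)))"
    unfolding B[symmetric] unfolding eq t_def v_def q_def dY_def
    by (rule fun_cong[OF frechet_derivative_at[OF has_derivative_\<Phi>_field[OF x u smooth_Y]], symmetric])
  also have "\<dots> = Z + s *\<^sub>R \<xi> (t, q)"
    unfolding Z_def s_def by (rule gauss_decomposition[OF t])
  also have "s = h (t, q) (frechet_derivative (\<Phi> \<circ> x') (at u) (X u))
      (frechet_derivative (\<Phi> \<circ> x') (at u) (Y u))"
    unfolding d\<Phi> h_emb[OF t] s_def ..
  also have "(t, q) = x' u"
    by (simp add: eq t_def q_def v_def interval_times_chart_def)
  finally have formula: "frechet_derivative (\<lambda>w. frechet_derivative (\<Phi> \<circ> x') (at w) (Y w)) (at u) (X u) =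
    Z + h (x' u) (frechet_derivative (\<Phi> \<circ> x') (at u) (X u))
      (frechet_derivative (\<Phi> \<circ> x') (at u) (Y u)) *\<^sub>R \<xi> (x' u)" .
  have "Z \<in> tangent_space \<A>I \<Phi> (t, q)"
    unfolding tangent_space_\<Phi>[OF t q] Z_def
    using DT z subspace_T[OF q] by (blast intro: subspace_add subspace_scale)
  then have "Z \<in> tangent_space \<A>I \<Phi> (x' u)"
    by (simp add: eq t_def q_def v_def interval_times_chart_def)
  with formula show "\<exists>Z\<in>tangent_space \<A>I \<Phi> (x' u).
      frechet_derivative (\<lambda>v. frechet_derivative (\<Phi> \<circ> x') (at v) (Y v)) (at u) (X u) =
      Z + h (x' u) (frechet_derivative (\<Phi> \<circ> x') (at u) (X u))
        (frechet_derivative (\<Phi> \<circ> x') (at u) (Y u)) *\<^sub>R \<xi> (x' u)"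
    by blast
qed

lemma volume_\<Phi>: "equal_volume_forms NI \<A>I \<Phi> \<xi> h"
  unfolding equal_volume_forms_def
proof clarify
  fix t q and X :: "3 \<Rightarrow> real^4" and e :: "4 \<Rightarrow> 3 option"
  assume tq: "(t, q) \<in> topspace NI" and X: "\<forall>i. X i \<in> tangent_space \<A>I \<Phi> (t, q)" and "bij e"
  have t: "t \<in> I" and q: "q \<in> topspace N"
    using tq by auto
  obtain U x u where x: "(U, x) \<in> \<A>" "u \<in> U" and xu: "x u = q"
    using q by (rule chart_exists)
  have "\<forall>i. \<exists>r w. X i = emb t q r (D x u w)"
    using X T_eq[OF x] unfolding xu tangent_space_\<Phi>[OF t q] by fastforce
  then obtain r w where X_eq: "\<And>i. X i = emb t q (r i) (D x u (w i))"
    by metis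
  define E where "E k = D x u (axis k 1)" for k
  define M :: "real^3^3" where "M = (\<chi> i. cons_vec (r i) (w i))"
  \<comment> \<open>A reference enumeration placing \<xi> in the last row, as the block determinant
    requires.\<close>
  define i :: "4 \<Rightarrow> 3 option" where
    "i k = (if k = 1 then Some 1 else if k = 2 then Some 2 else if k = 3 then Some 3 else None)" for k
  have "surj i"
  proof (rule surjI)
    show "i (case k of Some j \<Rightarrow> (if j = 1 then 1 else if j = 2 then 2 else 3) | None \<Rightarrow> 4) = k" for k
      using exhaust_3[of "the k"] by (auto simp: i_def split: option.split)
  qed
  moreover have "inj i"
    unfolding inj_def forall_4 by (simp add: i_def)
  ultimately have "bij i"
    by (simp add: bij_def)
  have rows: "X j = r j *\<^sub>R emb t q 1 0 + (w j $ 1) *\<^sub>R emb t q 0 (E 1) + (w j $ 2) *\<^sub>R emb t q 0 (E 2)" for j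
    unfolding X_eq D_expand[OF x, of "w j"]
    by (simp add: E_def emb_def cons_vec4_add cons_vec4_scaleR algebra_simps)
  have "\<bar>det (\<chi> k. case e k of Some j \<Rightarrow> X j | None \<Rightarrow> \<xi> (t, q))\<bar> =
      \<bar>det (\<chi> k. case i k of Some j \<Rightarrow> X j | None \<Rightarrow> \<xi> (t, q))\<bar>"
    by (rule abs_det_row_enumeration[OF \<open>bij e\<close> \<open>bij i\<close>])
  also have "(\<chi> k. case i k of Some j \<Rightarrow> X j | None \<Rightarrow> \<xi> (t, q)) = vector [X 1, X 2, X 3, \<xi> (t, q)]"
    by (simp add: vec_eq_iff[of _ "vector _"] forall_4 i_def)
  also have "det \<dots> = det M * det (vector [emb t q 1 0, emb t q 0 (E 1), emb t q 0 (E 2), \<xi> (t, q)])"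
    unfolding rows M_def by (rule det_rows_block)
  also have "det (vector [emb t q 1 0, emb t q 0 (E 1), emb t q 0 (E 2), \<xi> (t, q)] :: real^4^4) =
      - (W t * (\<gamma>2 t)\<^sup>2) * det (vector [E 1, E 2, \<phi> q] :: real^3^3)"
    using det_frame[of "deriv \<gamma>1 t" "deriv \<gamma>2 t" "\<phi> q" "\<gamma>2 t" "E 1" "E 2" "c - H * \<gamma>1 t" "- H * \<gamma>2 t"]
    by (simp add: emb_def \<xi>_eq W_def algebra_simps)
  finally have lhs: "\<bar>det (\<chi> k. case e k of Some j \<Rightarrow> X j | None \<Rightarrow> \<xi> (t, q))\<bar>\<^sup>2 =
      (det M)\<^sup>2 * (W t * (\<gamma>2 t)\<^sup>2)\<^sup>2 * (det (vector [E 1, E 2, \<phi> q] :: real^3^3))\<^sup>2"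
    by (simp add: power_mult_distrib)
  have "h (t, q) (X j) (X l) = \<alpha> t * (r j * r l) +
      \<beta> t * (\<Sum>k\<in>UNIV. \<Sum>m\<in>UNIV. w j $ k * w l $ m * g q (E k) (E m))" for j l
    unfolding X_eq h_emb[OF t] E_def xu[symmetric] metric_expand[OF x, of "w j" "w l"] ..
  then have "det (\<chi> j l. h (t, q) (X j) (X l)) = (det M)\<^sup>2 *
      (\<alpha> t * (\<beta> t)\<^sup>2 * (g q (E 1) (E 1) * g q (E 2) (E 2) - g q (E 1) (E 2) * g q (E 2) (E 1)))"
    unfolding M_def using det_gram_block[of "\<alpha> t" r "\<beta> t" w "\<lambda>k m. g q (E k) (E m)"] by simp
  then have "\<bar>det (\<chi> j l. h (t, q) (X j) (X l))\<bar> = (det M)\<^sup>2 * \<bar>\<alpha> t * (\<beta> t)\<^sup>2\<bar> *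
      \<bar>g q (E 1) (E 1) * g q (E 2) (E 2) - g q (E 1) (E 2) * g q (E 2) (E 1)\<bar>"
    by (simp add: abs_mult)
  \<comment> \<open>The determinant of \<open>g\<close> is the squared frame determinant of \<phi>,
    and the curve equation matches the factors depending on t. Comparing squares suffices because
    the volume is nonnegative.\<close>
  also have "\<dots> = \<bar>det (\<chi> k. case e k of Some j \<Rightarrow> X j | None \<Rightarrow> \<xi> (t, q))\<bar>\<^sup>2"
    unfolding lhs \<alpha>_\<beta>_volume[OF t] using volume_squared[OF x] by (simp add: E_def xu)
  finally show "\<bar>det (\<chi> k. case e k of Some j \<Rightarrow> X j | None \<Rightarrow> \<xi> (t, q))\<bar> =
      sqrt \<bar>det (\<chi> j l. h (t, q) (X j) (X l))\<bar>"
    by simp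
qed

lemma affine_sphere_\<Phi>: "affine_sphere NI \<A>I \<Phi> \<xi> h H"
  unfolding affine_sphere_def affine_normal_def
  using immersed transversal gauss_\<Phi> weingarten nondegenerate volume_\<Phi>
  by (intro exI[of _ "\<lambda>_ v. H *\<^sub>R v"]) simp

end

section \<open>The proper and improper cases\<close>

theorem theorem2:
  fixes N :: "'p topology" and \<A> :: "(2, 'p) atlas" and \<phi> :: "'p \<Rightarrow> real^3"
    and \<epsilon>1 :: real and I :: "real set" and \<gamma>1 \<gamma>2 :: "real \<Rightarrow> real"
  assumes "\<epsilon>1 = 1 \<or> \<epsilon>1 = -1"
    and "elliptic_affine_sphere N \<A> \<phi> (\<lambda>p. - \<epsilon>1 *\<^sub>R \<phi> p) \<epsilon>1 \<or>
         hyperbolic_affine_sphere N \<A> \<phi> (\<lambda>p. - \<epsilon>1 *\<^sub>R \<phi> p) \<epsilon>1"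
    and "open I" and "is_interval I" and "I \<noteq> {}"
    and "smooth_on I \<gamma>1" and "smooth_on I \<gamma>2"
  shows
    "((\<forall>t\<in>I.
        (\<gamma>2 t)\<^sup>2 * \<bar>\<gamma>1 t * deriv \<gamma>2 t - deriv \<gamma>1 t * \<gamma>2 t\<bar> ^ 5 =
          sgn (deriv \<gamma>1 t * \<gamma>2 t * \<epsilon>1) *
          (deriv \<gamma>1 t * deriv (deriv \<gamma>2) t - deriv (deriv \<gamma>1) t * deriv \<gamma>2 t) *
          (deriv \<gamma>1 t)\<^sup>2 \<and>
        (\<gamma>2 t)\<^sup>2 * \<bar>\<gamma>1 t * deriv \<gamma>2 t - deriv \<gamma>1 t * \<gamma>2 t\<bar> ^ 5 \<noteq> 0) \<longrightarrow>
      indefinite_proper_affine_sphere (prod_topology (top_of_set I) N)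
        (interval_times_atlas I \<A>) (warped_immersion \<gamma>1 \<gamma>2 \<phi>)) \<and>
     ((\<forall>t\<in>I.
        (\<gamma>2 t)\<^sup>2 * \<bar>deriv \<gamma>2 t\<bar> ^ 5 =
          sgn (deriv \<gamma>1 t * \<gamma>2 t * \<epsilon>1) *
          (deriv \<gamma>1 t * deriv (deriv \<gamma>2) t - deriv (deriv \<gamma>1) t * deriv \<gamma>2 t) *
          (deriv \<gamma>1 t)\<^sup>2 \<and>
        (\<gamma>2 t)\<^sup>2 * \<bar>deriv \<gamma>2 t\<bar> ^ 5 \<noteq> 0) \<longrightarrow>
      indefinite_improper_affine_sphere (prod_topology (top_of_set I) N)
        (interval_times_atlas I \<A>) (warped_immersion \<gamma>1 \<gamma>2 \<phi>))"
proof -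
  obtain g where "affine_sphere N \<A> \<phi> (\<lambda>p. - \<epsilon>1 *\<^sub>R \<phi> p) g \<epsilon>1"
    and "positive_definite_metric N \<A> \<phi> g"
    using assms(2) unfolding elliptic_affine_sphere_def hyperbolic_affine_sphere_def by blast
  then interpret centroaffine_surface N \<A> \<phi> \<epsilon>1 \<epsilon>1 g
    using assms(1) by unfold_locales
  interpret proper: warped_surface N \<A> \<phi> \<epsilon>1 \<epsilon>1 g I \<gamma>1 \<gamma>2 0 1
    using assms by unfold_locales
  interpret improper: warped_surface N \<A> \<phi> \<epsilon>1 \<epsilon>1 g I \<gamma>1 \<gamma>2 1 0
    using assms by unfold_locales
  \<comment> \<open>In the proper case \<open>W\<close> is the negative of the expression in the
    theorem; the curve condition sees only its absolute value.\<close>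
  have W: "\<bar>proper.W t\<bar> = \<bar>\<gamma>1 t * deriv \<gamma>2 t - deriv \<gamma>1 t * \<gamma>2 t\<bar>"
    "\<bar>improper.W t\<bar> = \<bar>deriv \<gamma>2 t\<bar>" for t
    by (simp_all add: proper.W_def improper.W_def abs_minus_commute mult.commute)
  show ?thesis
  proof (intro conjI impI)
    assume "\<forall>t\<in>I. (\<gamma>2 t)\<^sup>2 * \<bar>\<gamma>1 t * deriv \<gamma>2 t - deriv \<gamma>1 t * \<gamma>2 t\<bar> ^ 5 =
          sgn (deriv \<gamma>1 t * \<gamma>2 t * \<epsilon>1) *
          (deriv \<gamma>1 t * deriv (deriv \<gamma>2) t - deriv (deriv \<gamma>1) t * deriv \<gamma>2 t) *
          (deriv \<gamma>1 t)\<^sup>2 \<and>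
        (\<gamma>2 t)\<^sup>2 * \<bar>\<gamma>1 t * deriv \<gamma>2 t - deriv \<gamma>1 t * \<gamma>2 t\<bar> ^ 5 \<noteq> 0"
    then interpret proper: warped_affine_sphere N \<A> \<phi> \<epsilon>1 \<epsilon>1 g I \<gamma>1 \<gamma>2 0 1
      by unfold_locales (unfold W proper.K_def, blast+)
    show "indefinite_proper_affine_sphere (prod_topology (top_of_set I) N)
        (interval_times_atlas I \<A>) (warped_immersion \<gamma>1 \<gamma>2 \<phi>)"
      unfolding indefinite_proper_affine_sphere_def proper.\<Phi>_def[symmetric]
      using proper.affine_sphere_\<Phi> proper.indefinite zero_neq_one by metis
  next
    assume "\<forall>t\<in>I. (\<gamma>2 t)\<^sup>2 * \<bar>deriv \<gamma>2 t\<bar> ^ 5 =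
          sgn (deriv \<gamma>1 t * \<gamma>2 t * \<epsilon>1) *
          (deriv \<gamma>1 t * deriv (deriv \<gamma>2) t - deriv (deriv \<gamma>1) t * deriv \<gamma>2 t) *
          (deriv \<gamma>1 t)\<^sup>2 \<and>
        (\<gamma>2 t)\<^sup>2 * \<bar>deriv \<gamma>2 t\<bar> ^ 5 \<noteq> 0"
    then interpret improper: warped_affine_sphere N \<A> \<phi> \<epsilon>1 \<epsilon>1 g I \<gamma>1 \<gamma>2 1 0
      by unfold_locales (unfold W improper.K_def, blast+)
    show "indefinite_improper_affine_sphere (prod_topology (top_of_set I) N)
        (interval_times_atlas I \<A>) (warped_immersion \<gamma>1 \<gamma>2 \<phi>)"
      unfolding indefinite_improper_affine_sphere_def improper.\<Phi>_def[symmetric]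
      using improper.affine_sphere_\<Phi> improper.indefinite by metis
  qed
qed

end
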